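(* Let $n\ge 1$ and let $G$ be a group generated by $n$ elements. Then $G$ is free of rank $n$ if and only if $\mathrm{Dim}(R(G))=3n$.
   Context: For a finitely generated group $G$ with generators $x_1,\dots,x_n$, $R(G)=\mathrm{Hom}(G,SL_2\mathbb{C})$ is the representation variety of $G$: the complex affine algebraic set of all $n$-tuples in $(SL_2\mathbb{C})^n$ satisfying the relations of $G$. Up to isomorphism of algebraic varieties it does not depend on the chosen finite generating set. $\mathrm{Dim}$ denotes the (Krull) dimension. *)

theory Defs
  imports "HOL-Analysis.Analysis" "HOL-Algebra.Generated_Groups" "HOL-Library.Extended_Nat"
begin

section \<open>Words and free groups\<close>

text \<open>The letter \<open>(i, True)\<close> stands for the generator \<open>x\<^sub>i\<close>, the letter \<open>(i, False)\<close> for its inverse.\<close>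

type_synonym letter = "nat \<times> bool"

definition flip :: "letter \<Rightarrow> letter" where
  "flip a = (fst a, \<not> snd a)"

definition words :: "nat \<Rightarrow> letter list set" where
  "words n = lists ({..<n} \<times> UNIV)"

definition word_value :: "('a, 'b) monoid_scheme \<Rightarrow> (nat \<Rightarrow> 'a) \<Rightarrow> letter list \<Rightarrow> 'a" where
  "word_value G x w =
     foldr (\<lambda>a g. (if snd a then x (fst a) else inv\<^bsub>G\<^esub> (x (fst a))) \<otimes>\<^bsub>G\<^esub> g) w \<one>\<^bsub>G\<^esub>"

definition reduced :: "letter list \<Rightarrow> bool" where
  "reduced w \<longleftrightarrow> successively (\<lambda>a b. b \<noteq> flip a) w"

fun push :: "letter \<Rightarrow> letter list \<Rightarrow> letter list" where
  "push a [] = [a]"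
| "push a (b # w) = (if b = flip a then w else a # b # w)"

text \<open>For reduced words \<open>u\<close> and \<open>v\<close>, \<open>foldr push u v\<close> is the free reduction of the
  concatenation \<open>u @ v\<close>.\<close>

definition free_group :: "nat \<Rightarrow> letter list monoid" where
  "free_group n =
     \<lparr>carrier = {w \<in> words n. reduced w}, mult = foldr push, one = []\<rparr>"

lemma flip_flip [simp]: "flip (flip a) = a"
  by (simp add: flip_def)

lemma flip_neq [simp]: "flip a \<noteq> a" "a \<noteq> flip a"
  by (simp_all add: flip_def prod_eq_iff)

lemma flip_eq_iff [simp]: "flip a = flip b \<longleftrightarrow> a = b"
  by (metis flip_flip)

lemma reduced_Nil [simp]: "reduced []"
  by (simp add: reduced_def)

lemma reduced_Cons: "reduced (a # w) \<longleftrightarrow> reduced w \<and> (w = [] \<or> hd w \<noteq> flip a)"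
  by (auto simp: reduced_def successively_Cons)

lemma reduced_push: "reduced w \<Longrightarrow> reduced (push a w)"
  by (cases w) (auto simp: reduced_Cons)

lemma reduced_foldr_push: "reduced v \<Longrightarrow> reduced (foldr push u v)"
  by (induction u) (auto intro: reduced_push)

lemma push_flip_push: "reduced w \<Longrightarrow> push (flip a) (push a w) = w"
  by (cases w; cases "tl w") (auto simp: reduced_Cons)

lemma push_push_flip: "reduced w \<Longrightarrow> push a (push (flip a) w) = w"
  using push_flip_push[of w "flip a"] by simp

lemma foldr_push_reduced: "reduced u \<Longrightarrow> foldr push u [] = u"
proof (induction u)
  case (Cons a u)
  then show ?case by (cases u) (auto simp: reduced_Cons)
qed simp

lemma foldr_push_push: "reduced w \<Longrightarrow> foldr push (push a v) w = push a (foldr push v w)"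
  by (cases v) (auto simp: push_push_flip reduced_foldr_push)

lemma foldr_push_assoc:
  "reduced w \<Longrightarrow> foldr push (foldr push u v) w = foldr push u (foldr push v w)"
  by (induction u) (auto simp: foldr_push_push)

lemma foldr_push_inverse: "foldr push (rev (map flip u)) u = []"
  by (induction u) auto

lemma reduced_inverse: "reduced u \<Longrightarrow> reduced (rev (map flip u))"
  unfolding reduced_def successively_rev successively_map
  by (erule successively_mono) (metis flip_flip)

lemma words_Nil [simp]: "[] \<in> words n"
  by (simp add: words_def)

lemma words_Cons [simp]: "a # w \<in> words n \<longleftrightarrow> fst a < n \<and> w \<in> words n"
  by (cases a) (auto simp: words_def)

lemma words_append [simp]: "u @ v \<in> words n \<longleftrightarrow> u \<in> words n \<and> v \<in> words n"
  by (auto simp: words_def)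

lemma words_inverse: "u \<in> words n \<Longrightarrow> rev (map flip u) \<in> words n"
  by (induction u) (auto simp: flip_def)

lemma words_push: "fst a < n \<Longrightarrow> w \<in> words n \<Longrightarrow> push a w \<in> words n"
  by (cases w) auto

lemma words_foldr_push: "u \<in> words n \<Longrightarrow> v \<in> words n \<Longrightarrow> foldr push u v \<in> words n"
  by (induction u) (auto simp: words_push)

lemma group_free_group: "group (free_group n)"
proof (rule groupI)
  fix u assume "u \<in> carrier (free_group n)"
  then show "\<exists>v\<in>carrier (free_group n). v \<otimes>\<^bsub>free_group n\<^esub> u = \<one>\<^bsub>free_group n\<^esub>"
    by (intro bexI[of _ "rev (map flip u)"])
       (auto simp: free_group_def foldr_push_inverse reduced_inverse words_inverse)
qed (auto simp: free_group_def foldr_push_assoc reduced_foldr_push words_foldr_push)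

section \<open>The Zariski topology on affine space and Krull dimension\<close>

text \<open>For a finite index set \<open>I\<close>, the affine space with coordinates indexed by \<open>I\<close> is
  \<open>I \<rightarrow>\<^sub>E UNIV\<close>.\<close>

inductive_set polynomial_functions :: "'i set \<Rightarrow> (('i \<Rightarrow> complex) \<Rightarrow> complex) set" for I where
  const: "(\<lambda>p. c) \<in> polynomial_functions I"
| coord: "i \<in> I \<Longrightarrow> (\<lambda>p. p i) \<in> polynomial_functions I"
| add: "f \<in> polynomial_functions I \<Longrightarrow> g \<in> polynomial_functions I \<Longrightarrow>
    (\<lambda>p. f p + g p) \<in> polynomial_functions I"
| mult: "f \<in> polynomial_functions I \<Longrightarrow> g \<in> polynomial_functions I \<Longrightarrow>
    (\<lambda>p. f p * g p) \<in> polynomial_functions I"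

definition zero_locus ::
  "'i set \<Rightarrow> (('i \<Rightarrow> complex) \<Rightarrow> complex) set \<Rightarrow> ('i \<Rightarrow> complex) set" where
  "zero_locus I F = {p \<in> I \<rightarrow>\<^sub>E UNIV. \<forall>f\<in>F. f p = 0}"

definition zariski :: "'i set \<Rightarrow> ('i \<Rightarrow> complex) topology" where
  "zariski I = topology (\<lambda>U. \<exists>F \<subseteq> polynomial_functions I. U = (I \<rightarrow>\<^sub>E UNIV) - zero_locus I F)"

definition irreducible_space :: "'a topology \<Rightarrow> bool" where
  "irreducible_space X \<longleftrightarrow> topspace X \<noteq> {} \<and>
     (\<forall>C D. closedin X C \<and> closedin X D \<and> C \<union> D = topspace X
        \<longrightarrow> C = topspace X \<or> D = topspace X)"

text \<open>The empty space gets dimension 0 here.\<close>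

definition krull_dim :: "'a topology \<Rightarrow> enat" where
  "krull_dim X = Sup {enat k | k. \<exists>C :: nat \<Rightarrow> 'a set.
     (\<forall>i\<le>k. closedin X (C i) \<and> irreducible_space (subtopology X (C i))) \<and>
     (\<forall>i<k. C i \<subset> C (Suc i))}"

lemma istopology_zariski:
  "istopology (\<lambda>U. \<exists>F \<subseteq> polynomial_functions I. U = (I \<rightarrow>\<^sub>E UNIV) - zero_locus I F)"
  unfolding istopology_def
proof (intro conjI allI impI)
  fix S T :: "('a \<Rightarrow> complex) set"
  assume "\<exists>F\<subseteq>polynomial_functions I. S = (I \<rightarrow>\<^sub>E UNIV) - zero_locus I F"
    and "\<exists>F\<subseteq>polynomial_functions I. T = (I \<rightarrow>\<^sub>E UNIV) - zero_locus I F"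
  then obtain F H where F: "F \<subseteq> polynomial_functions I" "S = (I \<rightarrow>\<^sub>E UNIV) - zero_locus I F"
    and H: "H \<subseteq> polynomial_functions I" "T = (I \<rightarrow>\<^sub>E UNIV) - zero_locus I H"
    by blast
  let ?P = "(\<lambda>(f, h) p. f p * h p) ` (F \<times> H)"
  have "?P \<subseteq> polynomial_functions I"
    using F(1) H(1) by (auto intro: polynomial_functions.mult)
  moreover have "S \<inter> T = (I \<rightarrow>\<^sub>E UNIV) - zero_locus I ?P"
    unfolding F(2) H(2) zero_locus_def by auto
  ultimately show "\<exists>F\<subseteq>polynomial_functions I. S \<inter> T = (I \<rightarrow>\<^sub>E UNIV) - zero_locus I F"
    by blast
next
  fix \<K> :: "('a \<Rightarrow> complex) set set"
  assume "\<forall>K\<in>\<K>. \<exists>F\<subseteq>polynomial_functions I. K = (I \<rightarrow>\<^sub>E UNIV) - zero_locus I F"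
  then obtain F where F: "\<And>K. K \<in> \<K> \<Longrightarrow> F K \<subseteq> polynomial_functions I"
    "\<And>K. K \<in> \<K> \<Longrightarrow> K = (I \<rightarrow>\<^sub>E UNIV) - zero_locus I (F K)"
    by metis
  have "\<Union>\<K> = (\<Union>K\<in>\<K>. (I \<rightarrow>\<^sub>E UNIV) - zero_locus I (F K))"
    using F(2) by auto
  also have "\<dots> = (I \<rightarrow>\<^sub>E UNIV) - zero_locus I (\<Union>K\<in>\<K>. F K)"
    unfolding zero_locus_def by auto
  finally show "\<exists>F\<subseteq>polynomial_functions I. \<Union>\<K> = (I \<rightarrow>\<^sub>E UNIV) - zero_locus I F"
    using F(1) by (intro exI[of _ "\<Union>K\<in>\<K>. F K"]) auto
qed

lemma openin_zariski:
  "openin (zariski I) U \<longleftrightarrow>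
     (\<exists>F \<subseteq> polynomial_functions I. U = (I \<rightarrow>\<^sub>E UNIV) - zero_locus I F)"
  by (simp add: zariski_def topology_inverse'[OF istopology_zariski])

lemma topspace_zariski: "topspace (zariski I) = I \<rightarrow>\<^sub>E UNIV"
proof (rule subset_antisym)
  have "openin (zariski I) (I \<rightarrow>\<^sub>E UNIV)"
    unfolding openin_zariski
    by (rule exI[of _ "{\<lambda>p. 1}"]) (auto simp: zero_locus_def intro: polynomial_functions.const)
  then show "I \<rightarrow>\<^sub>E UNIV \<subseteq> topspace (zariski I)"
    by (rule openin_subset)
  show "topspace (zariski I) \<subseteq> I \<rightarrow>\<^sub>E UNIV"
    using openin_topspace[of "zariski I"] unfolding openin_zariski by blast
qed

lemma closedin_zariski:
  "closedin (zariski I) C \<longleftrightarrow> (\<exists>F \<subseteq> polynomial_functions I. C = zero_locus I F)"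
proof -
  have sub: "zero_locus I F \<subseteq> I \<rightarrow>\<^sub>E UNIV" for F
    by (auto simp: zero_locus_def)
  show ?thesis
    unfolding closedin_def topspace_zariski openin_zariski
    using sub by (metis Diff_subset double_diff subset_refl)
qed

section \<open>Representation varieties in \<open>SL\<^sub>2\<close>\<close>

definition SL2 :: "(complex^2^2) monoid" where
  "SL2 = \<lparr>carrier = {A. det A = 1}, mult = (**), one = mat 1\<rparr>"

text \<open>The tuples satisfying the relations of \<open>G\<close> with respect to the generators
  \<open>x 0, \<dots>, x (n - 1)\<close>; below they are identified with \<open>Hom(G, SL\<^sub>2)\<close>.\<close>

definition rep_tuples :: "('a, 'b) monoid_scheme \<Rightarrow> nat \<Rightarrow> (nat \<Rightarrow> 'a) \<Rightarrow> (nat \<Rightarrow> complex^2^2) set"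
  where "rep_tuples G n x = {A \<in> {..<n} \<rightarrow>\<^sub>E carrier SL2.
     \<forall>w\<in>words n. word_value G x w = \<one>\<^bsub>G\<^esub> \<longrightarrow> word_value SL2 A w = \<one>\<^bsub>SL2\<^esub>}"

definition entry_indices :: "nat \<Rightarrow> (nat \<times> 2 \<times> 2) set" where
  "entry_indices n = {..<n} \<times> UNIV \<times> UNIV"

definition entries :: "nat \<Rightarrow> (nat \<Rightarrow> complex^2^2) \<Rightarrow> (nat \<times> 2 \<times> 2 \<Rightarrow> complex)" where
  "entries n A = (\<lambda>(i, j, k) \<in> entry_indices n. A i $ j $ k)"

definition rep_variety ::
  "('a, 'b) monoid_scheme \<Rightarrow> nat \<Rightarrow> (nat \<Rightarrow> 'a) \<Rightarrow> (nat \<times> 2 \<times> 2 \<Rightarrow> complex) topology" where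
  "rep_variety G n x = subtopology (zariski (entry_indices n)) (entries n ` rep_tuples G n x)"

lemma group_SL2: "group SL2"
proof (rule groupI)
  fix A assume A: "A \<in> carrier SL2"
  then have "invertible A"
    by (simp add: SL2_def invertible_det_nz)
  then obtain B where B: "B ** A = mat 1"
    by (auto simp: invertible_def)
  then have "det B * det A = 1"
    by (metis det_mul det_I)
  with A B show "\<exists>B\<in>carrier SL2. B \<otimes>\<^bsub>SL2\<^esub> A = \<one>\<^bsub>SL2\<^esub>"
    by (auto simp: SL2_def)
qed (auto simp: SL2_def det_mul matrix_mul_assoc)

lemma word_value_Nil [simp]: "word_value G x [] = \<one>\<^bsub>G\<^esub>"
  by (simp add: word_value_def)

lemma word_value_Cons [simp]:
  "word_value G x (a # w) =
     (if snd a then x (fst a) else inv\<^bsub>G\<^esub> (x (fst a))) \<otimes>\<^bsub>G\<^esub> word_value G x w"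
  by (simp add: word_value_def)

context group
begin

lemma word_value_closed:
  "x \<in> {..<n} \<rightarrow> carrier G \<Longrightarrow> w \<in> words n \<Longrightarrow> word_value G x w \<in> carrier G"
  by (induction w) auto

lemma word_value_append:
  assumes "x \<in> {..<n} \<rightarrow> carrier G" "u \<in> words n" "v \<in> words n"
  shows "word_value G x (u @ v) = word_value G x u \<otimes> word_value G x v"
  using assms(2)
proof (induction u)
  case Nil
  show ?case using word_value_closed[OF assms(1,3)] by simp
next
  case (Cons a u)
  then have "x (fst a) \<in> carrier G" "word_value G x u \<in> carrier G"
    using assms(1) word_value_closed[OF assms(1), of u] by auto
  with Cons show ?case
    using word_value_closed[OF assms(1,3)] by (simp add: m_assoc)
qed

lemma word_value_inverse:
  assumes "x \<in> {..<n} \<rightarrow> carrier G" "u \<in> words n"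
  shows "word_value G x (rev (map flip u)) = inv (word_value G x u)"
  using assms(2)
proof (induction u)
  case (Cons a u)
  then have *: "x (fst a) \<in> carrier G" "word_value G x u \<in> carrier G"
    using assms(1) word_value_closed[OF assms(1), of u] by auto
  have "word_value G x (rev (map flip (a # u))) =
      word_value G x (rev (map flip u)) \<otimes> word_value G x [flip a]"
    using word_value_append[OF assms(1), of "rev (map flip u)" "[flip a]"] Cons.prems
      words_inverse[of u n] by (simp add: flip_def)
  also have "word_value G x (rev (map flip u)) = inv (word_value G x u)"
    using Cons by simp
  also have "\<dots> \<otimes> word_value G x [flip a] = inv (word_value G x (a # u))"
    using * by (auto simp: flip_def inv_mult_group)
  finally show ?case .
qed simp

lemma word_value_surj:
  assumes "x \<in> {..<n} \<rightarrow> carrier G" "g \<in> generate G (x ` {..<n})"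
  shows "\<exists>w\<in>words n. word_value G x w = g"
  using assms(2)
proof induction
  case one
  show ?case by (rule bexI[of _ "[]"]) auto
next
  case (incl h)
  then obtain i where "i < n" "h = x i" by auto
  moreover from this have "x i \<in> carrier G" using assms(1) by auto
  ultimately show ?case by (intro bexI[of _ "[(i, True)]"]) auto
next
  case (inv h)
  then obtain i where "i < n" "h = x i" by auto
  moreover from this have "x i \<in> carrier G" using assms(1) by auto
  ultimately show ?case by (intro bexI[of _ "[(i, False)]"]) auto
next
  case (eng g h)
  then show ?case using word_value_append[OF assms(1)] by (metis words_append)
qed

lemma word_value_hom:
  assumes "group H" "\<rho> \<in> hom G H" "x \<in> {..<n} \<rightarrow> carrier G" "w \<in> words n"
  shows "word_value H (\<lambda>i\<in>{..<n}. \<rho> (x i)) w = \<rho> (word_value G x w)"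
proof -
  interpret \<rho>: group_hom G H \<rho>
    using assms(1,2) by (simp add: group_hom_def group_hom_axioms_def group_axioms)
  show ?thesis using assms(4)
  proof (induction w)
    case (Cons a w)
    then have "x (fst a) \<in> carrier G" "word_value G x w \<in> carrier G"
      using assms(3) word_value_closed[OF assms(3), of w] by auto
    with Cons show ?case by simp
  qed simp
qed

lemma rep_tuples_eq_hom:
  assumes x: "x \<in> {..<n} \<rightarrow> carrier G" and gen: "generate G (x ` {..<n}) = carrier G"
  shows "rep_tuples G n x = (\<lambda>\<rho>. \<lambda>i\<in>{..<n}. \<rho> (x i)) ` hom G SL2"
proof (intro subset_antisym subsetI)
  fix A assume "A \<in> (\<lambda>\<rho>. \<lambda>i\<in>{..<n}. \<rho> (x i)) ` hom G SL2"
  then obtain \<rho> where \<rho>: "\<rho> \<in> hom G SL2" "A = (\<lambda>i\<in>{..<n}. \<rho> (x i))" by blast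
  then interpret \<rho>: group_hom G SL2 \<rho>
    by (simp add: group_hom_def group_hom_axioms_def group_axioms group_SL2)
  have "\<rho> (x i) \<in> carrier SL2" if "i < n" for i
    using x that by (intro \<rho>.hom_closed) auto
  then show "A \<in> rep_tuples G n x"
    using word_value_hom[OF group_SL2 \<rho>(1) x]
    by (auto simp: rep_tuples_def \<rho>(2))
next
  interpret S: group SL2 by (rule group_SL2)
  fix A assume "A \<in> rep_tuples G n x"
  then have A: "A \<in> {..<n} \<rightarrow>\<^sub>E carrier SL2"
    and rel: "\<And>w. w \<in> words n \<Longrightarrow> word_value G x w = \<one> \<Longrightarrow> word_value SL2 A w = \<one>\<^bsub>SL2\<^esub>"
    by (auto simp: rep_tuples_def)
  from A have A': "A \<in> {..<n} \<rightarrow> carrier SL2" by auto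
  have eq: "word_value SL2 A u = word_value SL2 A v"
    if "u \<in> words n" "v \<in> words n" "word_value G x u = word_value G x v" for u v
  proof -
    have "word_value G x (u @ rev (map flip v)) = \<one>"
      using that word_value_closed[OF x]
      by (simp add: word_value_append[OF x] word_value_inverse[OF x] words_inverse)
    then have "word_value SL2 A (u @ rev (map flip v)) = \<one>\<^bsub>SL2\<^esub>"
      using that by (intro rel) (auto simp: words_inverse)
    then have "word_value SL2 A u \<otimes>\<^bsub>SL2\<^esub> inv\<^bsub>SL2\<^esub> (word_value SL2 A v) = \<one>\<^bsub>SL2\<^esub>"
      using that by (simp add: S.word_value_append[OF A'] S.word_value_inverse[OF A'] words_inverse)
    then show ?thesis
      using S.word_value_closed[OF A'] that by (metis S.inv_equality S.inv_inv S.inv_closed)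
  qed
  define \<omega> where "\<omega> g = (SOME w. w \<in> words n \<and> word_value G x w = g)" for g
  have \<omega>: "\<omega> g \<in> words n" "word_value G x (\<omega> g) = g" if "g \<in> carrier G" for g
  proof -
    have "\<exists>w. w \<in> words n \<and> word_value G x w = g"
      using word_value_surj[OF x] that gen by blast
    then have "\<omega> g \<in> words n \<and> word_value G x (\<omega> g) = g"
      unfolding \<omega>_def by (rule someI_ex)
    then show "\<omega> g \<in> words n" "word_value G x (\<omega> g) = g" by auto
  qed
  define \<rho> where "\<rho> g = word_value SL2 A (\<omega> g)" for g
  have "\<rho> \<in> hom G SL2"
  proof (rule homI)
    fix g h assume gh: "g \<in> carrier G" "h \<in> carrier G"
    then show "\<rho> g \<in> carrier SL2"
      unfolding \<rho>_def using \<omega> S.word_value_closed[OF A'] by blast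
    have "word_value SL2 A (\<omega> (g \<otimes> h)) = word_value SL2 A (\<omega> g @ \<omega> h)"
      using gh \<omega> by (intro eq) (auto simp: word_value_append[OF x])
    then show "\<rho> (g \<otimes> h) = \<rho> g \<otimes>\<^bsub>SL2\<^esub> \<rho> h"
      unfolding \<rho>_def using gh \<omega> by (simp add: S.word_value_append[OF A'])
  qed
  moreover have "A = (\<lambda>i\<in>{..<n}. \<rho> (x i))"
  proof
    fix i
    show "A i = (\<lambda>i\<in>{..<n}. \<rho> (x i)) i"
    proof (cases "i < n")
      case True
      then have xi: "x i \<in> carrier G" "A i \<in> carrier SL2" using x A by auto
      then have "word_value SL2 A (\<omega> (x i)) = word_value SL2 A [(i, True)]"
        using \<omega>[of "x i"] True by (intro eq) auto
      with xi True show ?thesis by (simp add: \<rho>_def)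
    qed (use A in \<open>auto simp: PiE_def extensional_def\<close>)
  qed
  ultimately show "A \<in> (\<lambda>\<rho>. \<lambda>i\<in>{..<n}. \<rho> (x i)) ` hom G SL2" by blast
qed

end

end

theory Submission
  imports Defs "HOL-Library.Function_Algebras" "HOL-Computational_Algebra.Polynomial"
begin

text \<open>
  Multiplying an upper, a lower and an upper triangular unipotent matrix in every factor gives a
  polynomial map from \<open>3 * n\<close>-dimensional affine space to \<open>SL\<^sub>2\<^sup>n\<close>.  It is dominant
  (\<open>parametrization_dense\<close>), so \<open>SL\<^sub>2\<^sup>n\<close> is irreducible and polynomial functions on it pull back
  injectively.

  Dimension is bounded from above through algebraic independence.  An equation that vanishes on a
  closed set, but not on a larger irreducible set, is algebraically independent of any independent
  family on the smaller one (\<open>alg_indep_on_step\<close>).  A chain of length \<open>k\<close> in the representation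
  variety therefore yields \<open>k\<close> independent functions on \<open>SL\<^sub>2\<^sup>n\<close>, and \<open>k\<close> independent polynomials
  in \<open>3 * n\<close> variables exist only if \<open>k \<le> 3 * n\<close>, by counting monomials
  (\<open>alg_indep_on_card_le\<close>).

  If some nontrivial reduced word is a relation of \<open>G\<close>, an entry of that word minus the entry of
  the identity matrix vanishes on the representation variety.  For a suitable entry it does not
  vanish on \<open>SL\<^sub>2\<^sup>n\<close>, because no nontrivial reduced word is an identity in \<open>SL\<^sub>2\<close>
  (\<open>word_value_SL2_faithful\<close>).  So it extends the independent family by one more function, and the
  dimension is less than \<open>3 * n\<close> (\<open>chain_length_less\<close>).  Hence dimension \<open>3 * n\<close> forces the given generators to be free.

  Conversely, if \<open>G\<close> is free of rank \<open>n\<close>, a free basis and the given generators are words in each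
  other, and evaluating these words gives inverse polynomial maps between the representation
  variety and \<open>SL\<^sub>2\<^sup>n\<close>.  The closures of the images of the coordinate subspaces under the
  parametrization then form a chain of length \<open>3 * n\<close> (\<open>chain_in_rep_variety\<close>).
\<close>

section \<open>Polynomial functions\<close>

lemma polynomial_functions_sum:
  "(\<And>s. s \<in> S \<Longrightarrow> f s \<in> polynomial_functions I) \<Longrightarrow>
     (\<lambda>p. \<Sum>s\<in>S. f s p) \<in> polynomial_functions I"
  by (induction S rule: infinite_finite_induct)
    (auto intro: polynomial_functions.intros)

lemma polynomial_functions_prod:
  "(\<And>s. s \<in> S \<Longrightarrow> f s \<in> polynomial_functions I) \<Longrightarrow>
     (\<lambda>p. \<Prod>s\<in>S. f s p) \<in> polynomial_functions I"
  by (induction S rule: infinite_finite_induct)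
    (auto intro: polynomial_functions.intros)

lemma polynomial_functions_power:
  "f \<in> polynomial_functions I \<Longrightarrow> (\<lambda>p. f p ^ m) \<in> polynomial_functions I"
  by (induction m) (auto intro: polynomial_functions.intros)

lemma polynomial_functions_uminus:
  "f \<in> polynomial_functions I \<Longrightarrow> (\<lambda>p. - f p) \<in> polynomial_functions I"
  using polynomial_functions.mult[OF polynomial_functions.const[of "-1"]] by simp

lemma polynomial_functions_diff:
  "f \<in> polynomial_functions I \<Longrightarrow> g \<in> polynomial_functions I \<Longrightarrow>
     (\<lambda>p. f p - g p) \<in> polynomial_functions I"
  using polynomial_functions.add[OF _ polynomial_functions_uminus, of f I g] by simp

lemmas polynomial_functions_intros = polynomial_functions.intros polynomial_functions_sum
  polynomial_functions_prod polynomial_functions_power polynomial_functions_uminus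
  polynomial_functions_diff

lemma polynomial_functions_compose:
  assumes "f \<in> polynomial_functions I"
    and "\<And>i. i \<in> I \<Longrightarrow> (\<lambda>q. \<phi> q i) \<in> polynomial_functions J"
  shows "(\<lambda>q. f (\<phi> q)) \<in> polynomial_functions J"
  using assms(1) by induction (auto intro: polynomial_functions.intros assms(2))

lemma polynomial_functions_on_line:
  assumes "f \<in> polynomial_functions I"
  shows "\<exists>F. \<forall>t. f (\<lambda>i. p i + t * (q i - p i)) = poly F t"
  using assms
proof induction
  case (const c)
  show ?case by (rule exI[of _ "[:c:]"]) simp
next
  case (coord i)
  show ?case by (rule exI[of _ "[:p i, q i - p i:]"]) simp
next
  case (add f g)
  then show ?case by (metis poly_add)
next
  case (mult f g)
  then show ?case by (metis poly_mult)
qed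

text \<open>A linear subspace is irreducible because a polynomial function that does not vanish
  identically on the line through two points has only finitely many zeros on it.\<close>

lemma polynomial_functions_no_zero_divisors:
  assumes f: "f \<in> polynomial_functions I" and g: "g \<in> polynomial_functions I"
    and line: "\<And>p q t. p \<in> E \<Longrightarrow> q \<in> E \<Longrightarrow> (\<lambda>i. p i + t * (q i - p i)) \<in> E"
    and zero: "\<And>p. p \<in> E \<Longrightarrow> f p * g p = 0"
  shows "(\<forall>p\<in>E. f p = 0) \<or> (\<forall>p\<in>E. g p = 0)"
proof (rule ccontr)
  assume "\<not> ?thesis"
  then obtain p q where pq: "p \<in> E" "q \<in> E" "f p \<noteq> 0" "g q \<noteq> 0" by blast
  obtain F where F: "\<And>t. f (\<lambda>i. p i + t * (q i - p i)) = poly F t"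
    using polynomial_functions_on_line[OF f] by blast
  obtain H where H: "\<And>t. g (\<lambda>i. p i + t * (q i - p i)) = poly H t"
    using polynomial_functions_on_line[OF g] by blast
  have "poly F 0 = f p" "poly H 1 = g q"
    using F[of 0] H[of 1] by simp_all
  with pq have "F * H \<noteq> 0" by auto
  moreover have "poly (F * H) t = 0" for t
    using zero[OF line[OF pq(1,2)], of t] F[of t] H[of t] by simp
  ultimately show False
    using poly_all_0_iff_0 by blast
qed

section \<open>Algebraic independence\<close>

definition monomial :: "nat \<Rightarrow> (nat \<Rightarrow> nat) \<Rightarrow> (nat \<Rightarrow> complex) \<Rightarrow> complex" where
  "monomial k \<alpha> v = (\<Prod>i<k. v i ^ \<alpha> i)"

text \<open>Extensional, so that distinct exponents give distinct monomials.\<close>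

definition exponents :: "nat \<Rightarrow> nat \<Rightarrow> (nat \<Rightarrow> nat) set" where
  "exponents k M = {..<k} \<rightarrow>\<^sub>E {..M}"

lemma finite_exponents [simp]: "finite (exponents k M)"
  by (simp add: exponents_def finite_PiE)

lemma card_exponents: "card (exponents k M) = (M + 1) ^ k"
  by (simp add: exponents_def card_PiE)

lemma monomial_polynomial:
  "(\<And>i. i < k \<Longrightarrow> f i \<in> polynomial_functions I) \<Longrightarrow>
     (\<lambda>p. monomial k \<alpha> (\<lambda>i. f i p)) \<in> polynomial_functions I"
  unfolding monomial_def by (intro polynomial_functions_intros) auto

lemma monomial_cong: "(\<And>i. i < k \<Longrightarrow> \<alpha> i = \<beta> i) \<Longrightarrow> (\<And>i. i < k \<Longrightarrow> u i = v i) \<Longrightarrow>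
  monomial k \<alpha> u = monomial k \<beta> v"
  unfolding monomial_def by (intro prod.cong) auto

text \<open>Algebraic independence of the restrictions to \<open>Z\<close> is encoded as linear independence of
  their monomials.  This turns the comparison of dimensions into a comparison of numbers of
  monomials.\<close>

definition alg_indep_on :: "'p set \<Rightarrow> nat \<Rightarrow> (nat \<Rightarrow> 'p \<Rightarrow> complex) \<Rightarrow> bool" where
  "alg_indep_on Z k f \<longleftrightarrow> (\<forall>M c.
     (\<forall>z\<in>Z. (\<Sum>\<alpha>\<in>exponents k M. c \<alpha> * monomial k \<alpha> (\<lambda>i. f i z)) = 0) \<longrightarrow>
     (\<forall>\<alpha>\<in>exponents k M. c \<alpha> = 0))"

lemma sum_exponents_Suc:
  "(\<Sum>\<alpha>\<in>exponents (Suc k) M. c \<alpha> * monomial (Suc k) \<alpha> v) =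
     (\<Sum>j\<le>M. (\<Sum>\<alpha>\<in>exponents k M. c (\<alpha>(k := j)) * monomial k \<alpha> v) * v k ^ j)"
proof -
  have inj: "inj_on (\<lambda>(y, g). g(k := y)) ({..M} \<times> exponents k M)"
    unfolding exponents_def by (rule inj_combinator) auto
  have img: "exponents (Suc k) M = (\<lambda>(y, g). g(k := y)) ` ({..M} \<times> exponents k M)"
    unfolding exponents_def lessThan_Suc PiE_insert_eq by simp
  have mon: "monomial (Suc k) (\<alpha>(k := j)) v = monomial k \<alpha> v * v k ^ j" for \<alpha> j
    by (simp add: monomial_def)
  show ?thesis
    unfolding img sum.reindex[OF inj]
    by (simp add: sum.cartesian_product o_def case_prod_unfold mon sum_distrib_right mult.assoc)
qed

text \<open>Comparing the values at \<open>g = 0\<close> shows that the constant coefficient of a relation in \<open>g\<close>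
  vanishes on \<open>Z\<close>, hence is trivial; irreducibility of \<open>Z'\<close> then cancels a factor \<open>g\<close>.  This is
  the reason why a strictly larger irreducible set has larger transcendence degree.\<close>

lemma alg_indep_on_step:
  assumes sub: "Z \<subseteq> Z'" and indep: "alg_indep_on Z k f"
    and f: "\<And>i. i < k \<Longrightarrow> f i \<in> polynomial_functions I" and g: "g \<in> polynomial_functions I"
    and gZ: "\<And>z. z \<in> Z \<Longrightarrow> g z = 0" and gZ': "\<exists>z\<in>Z'. g z \<noteq> 0"
    and dom: "\<And>u v. u \<in> polynomial_functions I \<Longrightarrow> v \<in> polynomial_functions I \<Longrightarrow>
      (\<forall>z\<in>Z'. u z * v z = 0) \<Longrightarrow> (\<forall>z\<in>Z'. u z = 0) \<or> (\<forall>z\<in>Z'. v z = 0)"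
  shows "alg_indep_on Z' (Suc k) (f(k := g))"
proof -
  define b where "b M c z = (\<Sum>\<alpha>\<in>exponents k M. c \<alpha> * monomial k \<alpha> (\<lambda>i. f i z))"
    for M c z
  have b_poly: "b M c \<in> polynomial_functions I" for M c
    unfolding b_def by (intro polynomial_functions_intros monomial_polynomial f)
  have b_zero: "\<forall>\<alpha>\<in>exponents k M. c \<alpha> = 0" if "\<And>z. z \<in> Z \<Longrightarrow> b M c z = 0" for M c
    using indep that unfolding alg_indep_on_def b_def by blast
  have main: "\<forall>j\<le>D. \<forall>\<alpha>\<in>exponents k M. c j \<alpha> = 0"
    if "\<forall>z\<in>Z'. (\<Sum>j\<le>D. b M (c j) z * g z ^ j) = 0" for D M c
    using that
  proof (induction D arbitrary: c)
    case 0
    then show ?case using b_zero[of M "c 0"] sub by auto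
  next
    case (Suc D)
    have split: "(\<Sum>j\<le>Suc D. b M (c j) z * g z ^ j) =
        b M (c 0) z + g z * (\<Sum>j\<le>D. b M (c (Suc j)) z * g z ^ j)" for z
      unfolding sum.atMost_Suc_shift by (simp add: sum_distrib_left mult_ac)
    have "b M (c 0) z = 0" if "z \<in> Z" for z
      using bspec[OF Suc.prems, of z] that sub gZ[OF that] unfolding split by auto
    from b_zero[OF this] have c0: "\<forall>\<alpha>\<in>exponents k M. c 0 \<alpha> = 0" by blast
    then have "b M (c 0) z = 0" for z
      by (simp add: b_def)
    with Suc.prems split have "\<forall>z\<in>Z'. g z * (\<Sum>j\<le>D. b M (c (Suc j)) z * g z ^ j) = 0"
      by simp
    moreover have "(\<lambda>z. \<Sum>j\<le>D. b M (c (Suc j)) z * g z ^ j) \<in> polynomial_functions I"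
      by (intro polynomial_functions_sum polynomial_functions.mult b_poly
          polynomial_functions_power g)
    ultimately have "\<forall>z\<in>Z'. (\<Sum>j\<le>D. b M (c (Suc j)) z * g z ^ j) = 0"
      using dom[OF g] gZ' by blast
    from Suc.IH[OF this] c0 show ?case
      by (metis Suc_le_mono not0_implies_Suc)
  qed
  show ?thesis
    unfolding alg_indep_on_def
  proof (intro allI impI ballI)
    fix M c \<alpha>
    assume zero: "\<forall>z\<in>Z'. (\<Sum>\<alpha>\<in>exponents (Suc k) M.
      c \<alpha> * monomial (Suc k) \<alpha> (\<lambda>i. (f(k := g)) i z)) = 0"
      and \<alpha>: "\<alpha> \<in> exponents (Suc k) M"
    have "monomial k \<alpha> (\<lambda>i. (f(k := g)) i z) = monomial k \<alpha> (\<lambda>i. f i z)" for \<alpha> z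
      by (intro monomial_cong) auto
    then have "\<forall>z\<in>Z'. (\<Sum>j\<le>M. b M (\<lambda>\<alpha>. c (\<alpha>(k := j))) z * g z ^ j) = 0"
      using zero unfolding sum_exponents_Suc by (simp add: b_def del: fun_upd_apply) simp
    then have *: "\<forall>j\<le>M. \<forall>\<beta>\<in>exponents k M. c (\<beta>(k := j)) = 0"
      by (rule main[where c = "\<lambda>j \<alpha>. c (\<alpha>(k := j))"])
    from \<alpha> obtain j \<beta> where "j \<le> M" "\<beta> \<in> exponents k M" "\<alpha> = \<beta>(k := j)"
      unfolding exponents_def lessThan_Suc PiE_insert_eq by auto
    with * show "c \<alpha> = 0" by blast
  qed
qed

lemma alg_indep_on_mono: "alg_indep_on Z k f \<Longrightarrow> Z \<subseteq> Z' \<Longrightarrow> alg_indep_on Z' k f"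
  unfolding alg_indep_on_def by blast

lemma alg_indep_on_0: "Z \<noteq> {} \<Longrightarrow> alg_indep_on Z 0 f"
  by (auto simp: alg_indep_on_def exponents_def monomial_def)

interpretation funs: vector_space "\<lambda>c (f :: 'p \<Rightarrow> complex) p. c * f p"
  by unfold_locales (auto simp: fun_eq_iff algebra_simps)

text \<open>The polynomials in \<open>N\<close> variables of degree at most \<open>d\<close> in each variable.\<close>

definition bounded_polys :: "nat \<Rightarrow> nat \<Rightarrow> ((nat \<Rightarrow> complex) \<Rightarrow> complex) set" where
  "bounded_polys N d = funs.span (monomial N ` exponents N d)"

lemma bounded_polys_mono: "d \<le> e \<Longrightarrow> bounded_polys N d \<subseteq> bounded_polys N e"
  unfolding bounded_polys_def by (intro funs.span_mono image_mono) (force simp: exponents_def PiE_iff)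

lemma bounded_polys_mult:
  assumes "f \<in> bounded_polys N d" "g \<in> bounded_polys N e"
  shows "(\<lambda>p. f p * g p) \<in> bounded_polys N (d + e)"
proof -
  let ?S = "bounded_polys N (d + e)"
  have add: "(\<lambda>p. u p + v p) \<in> ?S" if "u \<in> ?S" "v \<in> ?S" for u v
    using funs.span_add[OF that[unfolded bounded_polys_def]]
    by (simp add: bounded_polys_def plus_fun_def)
  have scale: "(\<lambda>p. c * u p) \<in> ?S" if "u \<in> ?S" for u c
    using that unfolding bounded_polys_def by (rule funs.span_scale)
  have zero: "(\<lambda>p. 0) \<in> ?S"
    using funs.span_zero unfolding bounded_polys_def zero_fun_def .
  have mon: "(\<lambda>p. monomial N \<alpha> p * monomial N \<beta> p) \<in> ?S"
    if "\<alpha> \<in> exponents N d" "\<beta> \<in> exponents N e" for \<alpha> \<beta>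
  proof -
    let ?\<gamma> = "\<lambda>i\<in>{..<N}. \<alpha> i + \<beta> i"
    have "?\<gamma> \<in> exponents N (d + e)"
      using that by (auto simp: exponents_def PiE_iff intro!: add_mono)
    moreover have "(\<lambda>p. monomial N \<alpha> p * monomial N \<beta> p) = monomial N ?\<gamma>"
      by (auto simp: monomial_def fun_eq_iff power_add prod.distrib)
    ultimately show ?thesis
      unfolding bounded_polys_def by (auto intro: funs.span_base)
  qed
  have "(\<lambda>p. monomial N \<alpha> p * g p) \<in> ?S" if "\<alpha> \<in> exponents N d" for \<alpha>
    using assms(2)[unfolded bounded_polys_def]
  proof (induction rule: funs.span_induct_alt)
    case base
    show ?case using zero by (simp add: zero_fun_def)
  next
    case (step c u v)
    then obtain \<beta> where "\<beta> \<in> exponents N e" "u = monomial N \<beta>" by auto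
    from add[OF scale[OF mon[OF that this(1)], of c] step(2)] this(2)
    show ?case by (simp add: algebra_simps)
  qed
  note mon_g = this
  show ?thesis
    using assms(1)[unfolded bounded_polys_def]
  proof (induction rule: funs.span_induct_alt)
    case base
    show ?case using zero by (simp add: zero_fun_def)
  next
    case (step c u v)
    then obtain \<alpha> where "\<alpha> \<in> exponents N d" "u = monomial N \<alpha>" by auto
    from add[OF scale[OF mon_g[OF this(1)], of c] step(2)] this(2)
    show ?case by (simp add: algebra_simps)
  qed
qed

lemma bounded_polys_one: "(\<lambda>p. 1) \<in> bounded_polys N 0"
proof -
  have "monomial N (\<lambda>i\<in>{..<N}. 0) = (\<lambda>p. 1)"
    by (simp add: monomial_def fun_eq_iff)
  moreover have "(\<lambda>i\<in>{..<N}. 0) \<in> exponents N 0"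
    by (auto simp: exponents_def)
  ultimately show ?thesis
    unfolding bounded_polys_def by (metis funs.span_base imageI)
qed

lemma bounded_polys_power: "f \<in> bounded_polys N d \<Longrightarrow> (\<lambda>p. f p ^ m) \<in> bounded_polys N (m * d)"
  by (induction m) (auto simp: bounded_polys_one intro: bounded_polys_mult)

lemma bounded_polys_monomial:
  assumes "\<And>i. i < k \<Longrightarrow> f i \<in> bounded_polys N d" "\<And>i. i < k \<Longrightarrow> \<alpha> i \<le> M"
  shows "(\<lambda>p. monomial k \<alpha> (\<lambda>i. f i p)) \<in> bounded_polys N (k * (M * d))"
  using assms
proof (induction k)
  case 0
  show ?case by (simp add: monomial_def bounded_polys_one)
next
  case (Suc k)
  have "(\<lambda>p. f k p ^ \<alpha> k) \<in> bounded_polys N (M * d)"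
    using bounded_polys_power[OF Suc.prems(1), of k "\<alpha> k"] Suc.prems(2)[of k]
      bounded_polys_mono[of "\<alpha> k * d" "M * d"] by auto
  from bounded_polys_mult[OF this Suc.IH] Suc.prems show ?case
    by (simp add: monomial_def mult.commute)
qed

lemma polynomial_functions_bounded:
  assumes "f \<in> polynomial_functions {..<N}"
  shows "\<exists>d. f \<in> bounded_polys N d"
  using assms
proof induction
  case (const c)
  show ?case
    using funs.span_scale[OF bounded_polys_one[unfolded bounded_polys_def], of c]
    by (intro exI[of _ 0]) (simp add: bounded_polys_def)
next
  case (coord i)
  have "(\<Prod>j<N. p j ^ (if j = i then 1 else 0)) = p i" for p :: "nat \<Rightarrow> complex"
    using coord prod.remove[of "{..<N}" i "\<lambda>j. p j ^ (if j = i then 1 else 0)"] by simp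
  then have "(\<lambda>p. p i) = monomial N (\<lambda>j\<in>{..<N}. if j = i then 1 else 0)"
    by (auto simp: monomial_def fun_eq_iff)
  moreover have "(\<lambda>j\<in>{..<N}. if j = i then 1 else 0) \<in> exponents N 1"
    by (auto simp: exponents_def)
  ultimately have "(\<lambda>p. p i) \<in> bounded_polys N 1"
    unfolding bounded_polys_def by (metis funs.span_base imageI)
  then show ?case by blast
next
  case (add f g)
  then obtain d e where "f \<in> bounded_polys N d" "g \<in> bounded_polys N e" by blast
  then have "f \<in> bounded_polys N (d + e)" "g \<in> bounded_polys N (d + e)"
    using bounded_polys_mono[of d "d + e"] bounded_polys_mono[of e "d + e"] by auto
  from funs.span_add[OF this[unfolded bounded_polys_def]] show ?case
    unfolding bounded_polys_def plus_fun_def by blast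
next
  case (mult f g)
  then show ?case using bounded_polys_mult by blast
qed

text \<open>Independence of \<open>k\<close> polynomials in \<open>N\<close> variables gives \<open>(M + 1) ^ k\<close> linearly independent
  monomials in them, whose degrees are linear in \<open>M\<close>; so they lie in a space whose
  dimension grows only like \<open>M ^ N\<close>.\<close>

lemma alg_indep_on_card_le:
  assumes indep: "alg_indep_on UNIV k f"
    and f: "\<And>i. i < k \<Longrightarrow> f i \<in> polynomial_functions {..<N}"
  shows "k \<le> N"
proof (rule ccontr)
  assume "\<not> k \<le> N"
  then have kN: "Suc N \<le> k" by simp
  have "\<forall>i\<in>{..<k}. \<exists>d. f i \<in> bounded_polys N d"
    using polynomial_functions_bounded f by blast
  then obtain \<delta> where \<delta>: "\<And>i. i < k \<Longrightarrow> f i \<in> bounded_polys N (\<delta> i)"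
    by (metis lessThan_iff)
  define d where "d = (\<Sum>i<k. \<delta> i)"
  have fd: "f i \<in> bounded_polys N d" if "i < k" for i
    using \<delta>[OF that] bounded_polys_mono[of "\<delta> i" d N] that unfolding d_def
    by (meson finite_lessThan lessThan_iff member_le_sum subsetD zero_le)
  \<comment> \<open>large enough for \<open>(M + 1) ^ Suc N\<close> to exceed \<open>((k * d + 1) * (M + 1)) ^ N\<close>\<close>
  define M where "M = (k * d + 1) ^ N"
  define F where "F \<alpha> p = monomial k \<alpha> (\<lambda>i. f i p)" for \<alpha> p
  have lin: "\<forall>\<alpha>\<in>exponents k M. c \<alpha> = 0" if "\<And>p. (\<Sum>\<alpha>\<in>exponents k M. c \<alpha> * F \<alpha> p) = 0" for c
    using indep that unfolding alg_indep_on_def F_def by blast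
  have inj: "inj_on F (exponents k M)"
  proof (rule inj_onI, rule ccontr)
    fix \<alpha> \<beta> assume ab: "\<alpha> \<in> exponents k M" "\<beta> \<in> exponents k M" "F \<alpha> = F \<beta>" "\<alpha> \<noteq> \<beta>"
    let ?c = "\<lambda>\<gamma>. (if \<gamma> = \<alpha> then 1 else 0) - (if \<gamma> = \<beta> then 1 else 0 :: complex)"
    have "(\<Sum>\<gamma>\<in>exponents k M. ?c \<gamma> * F \<gamma> p) = F \<alpha> p - F \<beta> p" for p
      using ab by (simp add: left_diff_distrib sum_subtractf if_distrib[of "\<lambda>x. x * _"] cong: if_cong)
    with ab(3) have "\<forall>\<gamma>\<in>exponents k M. ?c \<gamma> = 0" by (intro lin) simp
    with ab show False by auto
  qed
  have sum_fun: "(\<Sum>v\<in>V. (\<lambda>p. c v * v p)) = (\<lambda>p. \<Sum>v\<in>V. c v * v p)"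
    for V and c :: "((nat \<Rightarrow> complex) \<Rightarrow> complex) \<Rightarrow> complex"
    by (induction V rule: infinite_finite_induct) (auto simp: zero_fun_def plus_fun_def)
  have scalars: "c v = 0"
    if zero: "(\<Sum>v\<in>F ` exponents k M. (\<lambda>p. c v * v p)) = 0" and v: "v \<in> F ` exponents k M"
    for c :: "((nat \<Rightarrow> complex) \<Rightarrow> complex) \<Rightarrow> complex" and v
  proof -
    have "(\<Sum>\<alpha>\<in>exponents k M. c (F \<alpha>) * F \<alpha> p) = 0" for p
      using zero unfolding sum_fun by (simp add: fun_eq_iff sum.reindex[OF inj])
    then have "\<forall>\<alpha>\<in>exponents k M. c (F \<alpha>) = 0"
      by (rule lin[of "\<lambda>\<alpha>. c (F \<alpha>)"])
    moreover obtain \<alpha> where "\<alpha> \<in> exponents k M" "v = F \<alpha>"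
      using v by (rule imageE)
    ultimately show "c v = 0" by simp
  qed
  have "funs.independent (F ` exponents k M)"
  proof
    assume "funs.dependent (F ` exponents k M)"
    then obtain c v where "v \<in> F ` exponents k M" "c v \<noteq> 0"
      "(\<Sum>v\<in>F ` exponents k M. (\<lambda>p. c v * v p)) = 0"
      by (auto simp only: funs.dependent_finite finite_imageI finite_exponents)
    then show False by (simp only: scalars[of c v])
  qed
  moreover have "F ` exponents k M \<subseteq> funs.span (monomial N ` exponents N (k * (M * d)))"
  proof (rule image_subsetI)
    fix \<alpha> assume "\<alpha> \<in> exponents k M"
    then have "F \<alpha> \<in> bounded_polys N (k * (M * d))"
      unfolding F_def by (intro bounded_polys_monomial fd) (auto simp: exponents_def PiE_iff)
    then show "F \<alpha> \<in> funs.span (monomial N ` exponents N (k * (M * d)))"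
      by (simp add: bounded_polys_def)
  qed
  ultimately have "card (F ` exponents k M) \<le> card (monomial N ` exponents N (k * (M * d)))"
    using funs.independent_span_bound[of "monomial N ` exponents N (k * (M * d))"] by simp
  also have "\<dots> \<le> card (exponents N (k * (M * d)))"
    by (rule card_image_le) simp
  finally have "(M + 1) ^ k \<le> (k * (M * d) + 1) ^ N"
    by (simp add: card_image[OF inj] card_exponents)
  also have "\<dots> \<le> ((k * d + 1) * (M + 1)) ^ N"
    by (intro power_mono) (auto simp: algebra_simps)
  also have "\<dots> = M * (M + 1) ^ N"
    by (simp only: power_mult_distrib M_def)
  also have "\<dots> < (M + 1) ^ Suc N"
    by simp
  also have "\<dots> \<le> (M + 1) ^ k"
    using kN by (intro power_increasing) auto
  finally show False by simp
qed

section \<open>Krull dimension\<close>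

text \<open>For nonempty \<open>Z\<close>, this says that the ring of polynomial functions on \<open>Z\<close> is an integral
  domain.\<close>

definition domain_on :: "'i set \<Rightarrow> ('i \<Rightarrow> complex) set \<Rightarrow> bool" where
  "domain_on I Z \<longleftrightarrow> (\<forall>f\<in>polynomial_functions I. \<forall>g\<in>polynomial_functions I.
     (\<forall>z\<in>Z. f z * g z = 0) \<longrightarrow> (\<forall>z\<in>Z. f z = 0) \<or> (\<forall>z\<in>Z. g z = 0))"

lemma closedin_subtopology_zariski:
  assumes "Z \<subseteq> I \<rightarrow>\<^sub>E UNIV"
  shows "closedin (subtopology (zariski I) Z) C \<longleftrightarrow>
    (\<exists>F\<subseteq>polynomial_functions I. C = {z \<in> Z. \<forall>f\<in>F. f z = 0})"
proof -
  have "zero_locus I F \<inter> Z = {z \<in> Z. \<forall>f\<in>F. f z = 0}" for F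
    using assms by (auto simp: zero_locus_def)
  then show ?thesis
    unfolding closedin_subtopology closedin_zariski by metis
qed

lemma irreducible_zariski_iff:
  assumes Z: "Z \<subseteq> I \<rightarrow>\<^sub>E UNIV"
  shows "irreducible_space (subtopology (zariski I) Z) \<longleftrightarrow> Z \<noteq> {} \<and> domain_on I Z"
proof -
  have top: "topspace (subtopology (zariski I) Z) = Z"
    using Z by (auto simp: topspace_zariski)
  show ?thesis
    unfolding irreducible_space_def top
  proof (intro conj_cong refl iffI)
    assume irr: "\<forall>C D. closedin (subtopology (zariski I) Z) C \<and>
      closedin (subtopology (zariski I) Z) D \<and> C \<union> D = Z \<longrightarrow> C = Z \<or> D = Z"
    show "domain_on I Z"
      unfolding domain_on_def
    proof (intro ballI impI)
      fix f g assume fg: "f \<in> polynomial_functions I" "g \<in> polynomial_functions I"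
        and zero: "\<forall>z\<in>Z. f z * g z = 0"
      have "closedin (subtopology (zariski I) Z) {z \<in> Z. h z = 0}"
        if "h \<in> polynomial_functions I" for h
        unfolding closedin_subtopology_zariski[OF Z] using that by (intro exI[of _ "{h}"]) auto
      then have "{z \<in> Z. f z = 0} = Z \<or> {z \<in> Z. g z = 0} = Z"
        using fg zero by (intro irr[rule_format]) auto
      then show "(\<forall>z\<in>Z. f z = 0) \<or> (\<forall>z\<in>Z. g z = 0)" by blast
    qed
  next
    assume dom: "domain_on I Z"
    show "\<forall>C D. closedin (subtopology (zariski I) Z) C \<and>
      closedin (subtopology (zariski I) Z) D \<and> C \<union> D = Z \<longrightarrow> C = Z \<or> D = Z"
    proof (intro allI impI, elim conjE)
      fix C D
      assume "closedin (subtopology (zariski I) Z) C" "closedin (subtopology (zariski I) Z) D"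
        and CD: "C \<union> D = Z"
      then obtain F H where F: "F \<subseteq> polynomial_functions I" "C = {z \<in> Z. \<forall>f\<in>F. f z = 0}"
        and H: "H \<subseteq> polynomial_functions I" "D = {z \<in> Z. \<forall>f\<in>H. f z = 0}"
        unfolding closedin_subtopology_zariski[OF Z] by blast
      show "C = Z \<or> D = Z"
      proof (rule ccontr)
        assume "\<not> ?thesis"
        then obtain f h u v where fh: "f \<in> F" "h \<in> H" "u \<in> Z" "v \<in> Z" "f u \<noteq> 0" "h v \<noteq> 0"
          using F(2) H(2) by blast
        have "f z * h z = 0" if "z \<in> Z" for z
          using CD F(2) H(2) fh(1,2) that by auto
        then show False
          using dom fh F(1) H(1) unfolding domain_on_def by blast
      qed
    qed
  qed
qed

text \<open>These are the chains that \<open>krull_dim\<close> measures, with closedness and irreducibility replaced by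
  their algebraic forms.\<close>

definition chain_in :: "'i set \<Rightarrow> ('i \<Rightarrow> complex) set \<Rightarrow> nat \<Rightarrow> (nat \<Rightarrow> ('i \<Rightarrow> complex) set) \<Rightarrow> bool"
  where "chain_in I Z k C \<longleftrightarrow>
    (\<forall>i\<le>k. (\<exists>F\<subseteq>polynomial_functions I. C i = {z \<in> Z. \<forall>f\<in>F. f z = 0}) \<and>
       C i \<noteq> {} \<and> domain_on I (C i)) \<and>
    (\<forall>i<k. C i \<subset> C (Suc i))"

lemma krull_dim_zariski:
  assumes Z: "Z \<subseteq> I \<rightarrow>\<^sub>E UNIV"
  shows "krull_dim (subtopology (zariski I) Z) = Sup {enat k | k. \<exists>C. chain_in I Z k C}"
proof -
  have "closedin (subtopology (zariski I) Z) C \<and>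
      irreducible_space (subtopology (subtopology (zariski I) Z) C) \<longleftrightarrow>
      (\<exists>F\<subseteq>polynomial_functions I. C = {z \<in> Z. \<forall>f\<in>F. f z = 0}) \<and> C \<noteq> {} \<and> domain_on I C" for C
  proof (cases "C \<subseteq> Z")
    case True
    then have "Z \<inter> C = C" "C \<subseteq> I \<rightarrow>\<^sub>E UNIV" using Z by auto
    then show ?thesis
      by (simp add: closedin_subtopology_zariski[OF Z] subtopology_subtopology irreducible_zariski_iff)
  qed (use closedin_subtopology_zariski[OF Z] in blast)
  then show ?thesis
    unfolding krull_dim_def chain_in_def by simp
qed

text \<open>An equation separating \<open>C i\<close> from \<open>C (Suc i)\<close> extends an independent family on \<open>C i\<close>.\<close>

lemma alg_indep_on_chain:
  assumes "chain_in I Z k C"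
  shows "\<exists>f. (\<forall>i<k. f i \<in> polynomial_functions I) \<and> alg_indep_on (C k) k f"
proof -
  have "\<exists>f. (\<forall>i<j. f i \<in> polynomial_functions I) \<and> alg_indep_on (C j) j f" if "j \<le> k" for j
    using that
  proof (induction j)
    case 0
    then show ?case using assms alg_indep_on_0[of "C 0"] by (auto simp: chain_in_def)
  next
    case (Suc j)
    then obtain f where f: "\<forall>i<j. f i \<in> polynomial_functions I" "alg_indep_on (C j) j f"
      by auto
    have j: "C j \<subset> C (Suc j)" "domain_on I (C (Suc j))"
      using assms Suc.prems by (auto simp: chain_in_def)
    obtain F where F: "F \<subseteq> polynomial_functions I" "C j = {z \<in> Z. \<forall>f\<in>F. f z = 0}"
      using assms Suc.prems unfolding chain_in_def by (meson Suc_leD)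
    have H: "C (Suc j) \<subseteq> Z"
      using assms Suc.prems unfolding chain_in_def by blast
    obtain z g where g: "z \<in> C (Suc j)" "g \<in> F" "g z \<noteq> 0"
      using j(1) H unfolding F(2) by blast
    have "alg_indep_on (C (Suc j)) (Suc j) (f(j := g))"
    proof (rule alg_indep_on_step[OF _ f(2), where I = I])
      show "u \<in> polynomial_functions I \<Longrightarrow> v \<in> polynomial_functions I \<Longrightarrow>
        \<forall>z\<in>C (Suc j). u z * v z = 0 \<Longrightarrow>
        (\<forall>z\<in>C (Suc j). u z = 0) \<or> (\<forall>z\<in>C (Suc j). v z = 0)" for u v
        using j(2) unfolding domain_on_def by blast
    qed (use f(1) g F j(1) in auto)
    moreover have "\<forall>i<Suc j. (f(j := g)) i \<in> polynomial_functions I"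
      using f(1) g(2) F(1) by (auto simp: less_Suc_eq)
    ultimately show ?case by blast
  qed
  then show ?thesis by blast
qed

definition coordinate_subspace :: "nat \<Rightarrow> (nat \<Rightarrow> complex) set" where
  "coordinate_subspace k = {q. \<forall>i\<ge>k. q i = 0}"

text \<open>The chain consists of the closures of the images of the coordinate subspaces; \<open>g k\<close>
  witnesses that the \<open>k\<close>-th inclusion is strict.\<close>

lemma chain_in_of_parametrization:
  assumes \<phi>Z: "\<And>q. \<phi> q \<in> Z"
    and \<phi>: "\<And>i. i \<in> I \<Longrightarrow> (\<lambda>q. \<phi> q i) \<in> polynomial_functions J"
    and g: "\<And>k. k < N \<Longrightarrow> g k \<in> polynomial_functions I"
    and g0: "\<And>k q. k < N \<Longrightarrow> q \<in> coordinate_subspace k \<Longrightarrow> g k (\<phi> q) = 0"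
    and g1: "\<And>k. k < N \<Longrightarrow> \<exists>q\<in>coordinate_subspace (Suc k). g k (\<phi> q) \<noteq> 0"
  shows "\<exists>C. chain_in I Z N C"
proof -
  \<comment> \<open>the ideal of the closure \<open>C k\<close>\<close>
  define V where "V k = {f \<in> polynomial_functions I. \<forall>q\<in>coordinate_subspace k. f (\<phi> q) = 0}" for k
  define C where "C k = {z \<in> Z. \<forall>f\<in>V k. f z = 0}" for k
  have image: "\<phi> q \<in> C k" if "q \<in> coordinate_subspace k" for q k
    using that \<phi>Z by (auto simp: C_def V_def)
  have dom: "domain_on I (C k)" for k
    unfolding domain_on_def
  proof (intro ballI impI)
    fix f h assume fh: "f \<in> polynomial_functions I" "h \<in> polynomial_functions I"
      and zero: "\<forall>z\<in>C k. f z * h z = 0"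
    have "(\<forall>q\<in>coordinate_subspace k. f (\<phi> q) = 0) \<or> (\<forall>q\<in>coordinate_subspace k. h (\<phi> q) = 0)"
    proof (rule polynomial_functions_no_zero_divisors)
      show "(\<lambda>q. f (\<phi> q)) \<in> polynomial_functions J" "(\<lambda>q. h (\<phi> q)) \<in> polynomial_functions J"
        by (rule polynomial_functions_compose[OF fh(1) \<phi>] polynomial_functions_compose[OF fh(2) \<phi>],
            assumption)+
      show "(\<lambda>i. p i + t * (q i - p i)) \<in> coordinate_subspace k"
        if "p \<in> coordinate_subspace k" "q \<in> coordinate_subspace k" for p q t
        using that by (auto simp: coordinate_subspace_def)
      show "f (\<phi> q) * h (\<phi> q) = 0" if "q \<in> coordinate_subspace k" for q
        using image[OF that] zero by blast
    qed
    then show "(\<forall>z\<in>C k. f z = 0) \<or> (\<forall>z\<in>C k. h z = 0)"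
      using fh by (auto simp: C_def V_def)
  qed
  have nonempty: "C k \<noteq> {}" for k
    using image[of "\<lambda>i. 0" k] by (auto simp: coordinate_subspace_def)
  have strict: "C k \<subset> C (Suc k)" if k: "k < N" for k
  proof
    have "coordinate_subspace k \<subseteq> coordinate_subspace (Suc k)"
      by (auto simp: coordinate_subspace_def)
    then show "C k \<subseteq> C (Suc k)"
      by (auto simp: C_def V_def)
    obtain q where q: "q \<in> coordinate_subspace (Suc k)" "g k (\<phi> q) \<noteq> 0"
      using g1[OF k] by blast
    have "g k \<in> V k"
      using g[OF k] g0[OF k] by (simp add: V_def)
    with q have "\<phi> q \<notin> C k" by (auto simp: C_def)
    with image[OF q(1)] show "C k \<noteq> C (Suc k)" by blast
  qed
  have "V k \<subseteq> polynomial_functions I" for k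
    by (auto simp: V_def)
  then have "chain_in I Z N C"
    unfolding chain_in_def using dom nonempty strict
    by (intro conjI allI impI exI[of _ "V _"]) (simp_all add: C_def)
  then show ?thesis by blast
qed

lemma krull_dim_eqI:
  assumes Z: "Z \<subseteq> I \<rightarrow>\<^sub>E UNIV"
    and upper: "\<And>k C. chain_in I Z k C \<Longrightarrow> k \<le> N" and lower: "\<exists>C. chain_in I Z N C"
  shows "krull_dim (subtopology (zariski I) Z) = enat N"
  unfolding krull_dim_zariski[OF Z]
proof (rule antisym)
  show "Sup {enat k |k. \<exists>C. chain_in I Z k C} \<le> enat N"
    using upper by (intro Sup_least) auto
  show "enat N \<le> Sup {enat k |k. \<exists>C. chain_in I Z k C}"
    using lower by (intro Sup_upper) auto
qed

lemma krull_dim_eqD: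
  assumes Z: "Z \<subseteq> I \<rightarrow>\<^sub>E UNIV" and dim: "krull_dim (subtopology (zariski I) Z) = enat N"
    and "N > 0"
  shows "\<exists>C. chain_in I Z N C"
proof -
  let ?K = "{enat k |k. \<exists>C. chain_in I Z k C}"
  have Sup: "Sup ?K = enat N"
    using dim krull_dim_zariski[OF Z] by simp
  have "\<exists>x\<in>?K. enat (N - 1) < x"
    using less_Sup_iff[of "enat (N - 1)" ?K] \<open>N > 0\<close> unfolding Sup by simp
  then obtain k C where k: "N - 1 < k" "chain_in I Z k C" by auto
  have "enat k \<le> Sup ?K"
    using k(2) by (intro Sup_upper) auto
  with k(1) Sup have "k = N" by simp
  with k(2) show ?thesis by blast
qed

section \<open>The variety of tuples in \<open>SL\<^sub>2\<close>\<close>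

definition matrix2 :: "complex \<Rightarrow> complex \<Rightarrow> complex \<Rightarrow> complex \<Rightarrow> complex^2^2" where
  "matrix2 a b c d = vector [vector [a, b], vector [c, d]]"

lemma matrix2_sel [simp]:
  "matrix2 a b c d $ 1 $ 1 = a" "matrix2 a b c d $ 1 $ 2 = b"
  "matrix2 a b c d $ 2 $ 1 = c" "matrix2 a b c d $ 2 $ 2 = d"
  by (simp_all add: matrix2_def vector_2)

lemma matrix2_eq_iff: "(A :: complex^2^2) = B \<longleftrightarrow>
    A $ 1 $ 1 = B $ 1 $ 1 \<and> A $ 1 $ 2 = B $ 1 $ 2 \<and> A $ 2 $ 1 = B $ 2 $ 1 \<and> A $ 2 $ 2 = B $ 2 $ 2"
  by (auto simp: vec_eq_iff forall_2)

lemma carrier_SL2_iff: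
  "A \<in> carrier SL2 \<longleftrightarrow> A $ 1 $ 1 * A $ 2 $ 2 - A $ 1 $ 2 * A $ 2 $ 1 = 1"
  by (simp add: SL2_def det_2)

lemma SL2_mult_one [simp]: "mult SL2 = (**)" "one SL2 = mat 1"
  by (simp_all add: SL2_def)

lemma inv_SL2:
  assumes "A \<in> carrier SL2"
  shows "inv\<^bsub>SL2\<^esub> A = matrix2 (A $ 2 $ 2) (- A $ 1 $ 2) (- A $ 2 $ 1) (A $ 1 $ 1)"
proof (rule group.inv_equality[OF group_SL2 _ assms])
  let ?B = "matrix2 (A $ 2 $ 2) (- A $ 1 $ 2) (- A $ 2 $ 1) (A $ 1 $ 1)"
  show "?B \<otimes>\<^bsub>SL2\<^esub> A = \<one>\<^bsub>SL2\<^esub>"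
    using assms by (simp add: carrier_SL2_iff matrix2_eq_iff matrix_matrix_mult_def sum_2 mat_def algebra_simps)
  show "?B \<in> carrier SL2"
    using assms by (simp add: carrier_SL2_iff algebra_simps)
qed

abbreviation SL2_tuples :: "nat \<Rightarrow> (nat \<Rightarrow> complex^2^2) set" where
  "SL2_tuples n \<equiv> {..<n} \<rightarrow>\<^sub>E carrier SL2"

lemma entries_apply: "i < n \<Longrightarrow> entries n A (i, j, k) = A i $ j $ k"
  by (simp add: entries_def entry_indices_def)

lemma entries_in_affine_space: "entries n A \<in> entry_indices n \<rightarrow>\<^sub>E UNIV"
  by (simp add: entries_def)

lemma entry_polynomial:
  "i < n \<Longrightarrow> (\<lambda>p. p (i, j, k)) \<in> polynomial_functions (entry_indices n)"
  by (rule polynomial_functions.coord) (simp add: entry_indices_def)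

text \<open>This is the product of the unipotent matrices with off-diagonal entry \<open>s\<close> (upper), \<open>t\<close>
  (lower) and \<open>u\<close> (upper).\<close>

definition unipotent_product :: "complex \<Rightarrow> complex \<Rightarrow> complex \<Rightarrow> complex^2^2" where
  "unipotent_product s t u = matrix2 (1 + s * t) (s + (1 + s * t) * u) t (1 + t * u)"

definition parametrization :: "nat \<Rightarrow> (nat \<Rightarrow> complex) \<Rightarrow> nat \<Rightarrow> complex^2^2" where
  "parametrization n q =
     (\<lambda>i\<in>{..<n}. unipotent_product (q (3 * i)) (q (3 * i + 1)) (q (3 * i + 2)))"

lemma parametrization_SL2: "parametrization n q \<in> SL2_tuples n"
  by (auto simp: parametrization_def unipotent_product_def carrier_SL2_iff algebra_simps)

lemma parametrization_polynomial:
  assumes "i \<in> entry_indices n"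
  shows "(\<lambda>q. entries n (parametrization n q) i) \<in> polynomial_functions {..<3 * n}"
proof -
  obtain m j k where i: "i = (m, j, k)" "m < n"
    using assms by (auto simp: entry_indices_def)
  have coords: "(\<lambda>q. q (3 * m)) \<in> polynomial_functions {..<3 * n}"
    "(\<lambda>q. q (3 * m + 1)) \<in> polynomial_functions {..<3 * n}"
    "(\<lambda>q. q (3 * m + 2)) \<in> polynomial_functions {..<3 * n}"
    using i(2) by (auto intro!: polynomial_functions.coord)
  have "(\<lambda>q. unipotent_product (q (3 * m)) (q (3 * m + 1)) (q (3 * m + 2)) $ j $ k)
      \<in> polynomial_functions {..<3 * n}"
    using exhaust_2[of j] exhaust_2[of k]
    by (elim disjE; simp only: unipotent_product_def matrix2_sel;
        intro polynomial_functions.add polynomial_functions.mult polynomial_functions.const coords)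
  then show ?thesis
    using i(2) by (simp add: i(1) entries_apply parametrization_def)
qed

lemma parametrization_surj:
  assumes A: "A \<in> SL2_tuples n" and c: "\<And>i. i < n \<Longrightarrow> A i $ 2 $ 1 \<noteq> 0"
  shows "\<exists>q. parametrization n q = A"
proof (rule exI)
  \<comment> \<open>the lower left entry of the product is \<open>t\<close>; the diagonal then determines \<open>s\<close> and \<open>u\<close>\<close>
  let ?q = "\<lambda>m. let M = A (m div 3) in if m mod 3 = 0 then (M $ 1 $ 1 - 1) / M $ 2 $ 1
    else if m mod 3 = 1 then M $ 2 $ 1 else (M $ 2 $ 2 - 1) / M $ 2 $ 1"
  show "parametrization n ?q = A"
  proof
    fix i
    show "parametrization n ?q i = A i"
    proof (cases "i < n")
      case True
      then have "A i \<in> carrier SL2" using A by auto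
      have ix: "(3 * i) div 3 = i" "(3 * i) mod 3 = 0" "(3 * i + 1) div 3 = i" "(3 * i + 1) mod 3 = 1"
        "(3 * i + 2) div 3 = i" "(3 * i + 2) mod 3 = 2"
        by presburger+
      have "parametrization n ?q i =
          unipotent_product ((A i $ 1 $ 1 - 1) / A i $ 2 $ 1) (A i $ 2 $ 1) ((A i $ 2 $ 2 - 1) / A i $ 2 $ 1)"
        using True unfolding parametrization_def by (simp only: ix Let_def restrict_apply' lessThan_iff) simp
      also have "\<dots> = A i"
        using \<open>A i \<in> carrier SL2\<close> c[OF True]
        by (simp add: unipotent_product_def carrier_SL2_iff matrix2_eq_iff field_simps)
      finally show ?thesis .
    next
      case False
      then show ?thesis
        using PiE_arb[OF A, of i] by (simp add: parametrization_def)
    qed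
  qed
qed

text \<open>The image of the parametrization contains all tuples with nonzero lower left entries.
  A generic point of the line obtained by adding multiples of the first row to the second one is
  of this kind.\<close>

lemma parametrization_dense:
  assumes f: "f \<in> polynomial_functions (entry_indices n)"
    and zero: "\<And>q. f (entries n (parametrization n q)) = 0" and A: "A \<in> SL2_tuples n"
  shows "f (entries n A) = 0"
proof -
  define A' where "A' t = (\<lambda>i\<in>{..<n}. matrix2 (A i $ 1 $ 1) (A i $ 1 $ 2)
    (A i $ 2 $ 1 + t * A i $ 1 $ 1) (A i $ 2 $ 2 + t * A i $ 1 $ 2))" for t
  have A'0: "entries n (A' 0) = entries n A"
  proof
    fix i :: "nat \<times> 2 \<times> 2"
    obtain m j k where i: "i = (m, j, k)" by (cases i) auto
    show "entries n (A' 0) i = entries n A i"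
      using exhaust_2[of j] exhaust_2[of k] unfolding i
      by (cases "m < n") (auto simp: entries_def entry_indices_def A'_def)
  qed
  have A'_line: "entries n (A' t) =
      (\<lambda>i. entries n (A' 0) i + t * (entries n (A' 1) i - entries n (A' 0) i))" for t
  proof
    fix i :: "nat \<times> 2 \<times> 2"
    obtain m j k where i: "i = (m, j, k)" by (cases i) auto
    show "entries n (A' t) i = entries n (A' 0) i + t * (entries n (A' 1) i - entries n (A' 0) i)"
      using exhaust_2[of j] exhaust_2[of k] unfolding i
      by (cases "m < n") (auto simp: entries_def entry_indices_def A'_def algebra_simps)
  qed
  obtain F where
    F': "\<forall>t. f (\<lambda>i. entries n (A' 0) i + t * (entries n (A' 1) i - entries n (A' 0) i)) = poly F t"
    using polynomial_functions_on_line[OF f, of "entries n (A' 0)" "entries n (A' 1)"] by (rule exE)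
  have F: "f (entries n (A' t)) = poly F t" for t
    using F'[rule_format, of t] by (simp only: A'_line[of t, symmetric])
  let ?B = "\<Union>i<n. {- A i $ 2 $ 1 / A i $ 1 $ 1}"
  have root: "poly F t = 0" if t: "t \<notin> ?B" for t
  proof -
    have A't: "A' t i \<in> carrier SL2 \<and> A' t i $ 2 $ 1 \<noteq> 0" if i: "i < n" for i
    proof -
      have det: "A i $ 1 $ 1 * A i $ 2 $ 2 - A i $ 1 $ 2 * A i $ 2 $ 1 = 1"
        using PiE_mem[OF A, of i] i by (simp add: carrier_SL2_iff)
      have "A i $ 2 $ 1 + t * A i $ 1 $ 1 \<noteq> 0"
      proof (cases "A i $ 1 $ 1 = 0")
        case False
        have "t \<noteq> - A i $ 2 $ 1 / A i $ 1 $ 1" using t i by blast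
        moreover have "t = - A i $ 2 $ 1 / A i $ 1 $ 1" if "A i $ 2 $ 1 + t * A i $ 1 $ 1 = 0"
        proof -
          have "- A i $ 2 $ 1 = t * A i $ 1 $ 1"
            using that by (simp only: neg_eq_iff_add_eq_0)
          with False show ?thesis by (simp only: nonzero_mult_div_cancel_right not_False_eq_True)
        qed
        ultimately show ?thesis by blast
      qed (use det in auto)
      then show ?thesis
        using i det by (simp add: A'_def carrier_SL2_iff algebra_simps)
    qed
    have "A' t \<in> SL2_tuples n"
      by (rule PiE_I) (simp add: A't, simp add: A'_def)
    then have "\<exists>q. parametrization n q = A' t"
      by (rule parametrization_surj) (simp add: A't)
    then obtain q where "parametrization n q = A' t"
      by (rule exE)
    with zero[of q] show ?thesis
      by (simp add: F)
  qed
  have "UNIV - ?B \<subseteq> {t. poly F t = 0}"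
    by (intro subsetI CollectI root) (simp only: Diff_iff UNIV_I simp_thms)
  moreover have "infinite (UNIV - ?B)"
    by (intro Diff_infinite_finite infinite_UNIV_char_0) simp
  ultimately have "infinite {t. poly F t = 0}"
    by (rule infinite_super)
  then have "F = 0"
    using poly_roots_finite[of F] by (rule contrapos_np)
  then show ?thesis
    using F[of 0] by (simp add: A'0)
qed

lemma domain_on_SL2_tuples: "domain_on (entry_indices n) (entries n ` SL2_tuples n)"
  unfolding domain_on_def
proof (intro ballI impI)
  fix f g
  assume f: "f \<in> polynomial_functions (entry_indices n)"
    and g: "g \<in> polynomial_functions (entry_indices n)"
    and zero: "\<forall>z\<in>entries n ` SL2_tuples n. f z * g z = 0"
  let ?\<phi> = "\<lambda>q. entries n (parametrization n q)"
  have "(\<forall>q\<in>UNIV. f (?\<phi> q) = 0) \<or> (\<forall>q\<in>UNIV. g (?\<phi> q) = 0)"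
  proof (rule polynomial_functions_no_zero_divisors)
    show "(\<lambda>q. f (?\<phi> q)) \<in> polynomial_functions {..<3 * n}"
      by (rule polynomial_functions_compose[OF f parametrization_polynomial])
    show "(\<lambda>q. g (?\<phi> q)) \<in> polynomial_functions {..<3 * n}"
      by (rule polynomial_functions_compose[OF g parametrization_polynomial])
  qed (use zero parametrization_SL2 in auto)
  then show "(\<forall>z\<in>entries n ` SL2_tuples n. f z = 0) \<or> (\<forall>z\<in>entries n ` SL2_tuples n. g z = 0)"
    using parametrization_dense[OF f] parametrization_dense[OF g] by blast
qed

lemma alg_indep_on_SL2_tuples_le:
  assumes indep: "alg_indep_on (entries n ` SL2_tuples n) k f"
    and f: "\<And>i. i < k \<Longrightarrow> f i \<in> polynomial_functions (entry_indices n)"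
  shows "k \<le> 3 * n"
proof (rule alg_indep_on_card_le)
  let ?\<phi> = "\<lambda>q. entries n (parametrization n q)"
  show "(\<lambda>q. f i (?\<phi> q)) \<in> polynomial_functions {..<3 * n}" if "i < k" for i
    by (rule polynomial_functions_compose[OF f[OF that] parametrization_polynomial])
  show "alg_indep_on UNIV k (\<lambda>i q. f i (?\<phi> q))"
    unfolding alg_indep_on_def
  proof (intro allI impI)
    fix M c
    let ?R = "\<lambda>z. \<Sum>\<alpha>\<in>exponents k M. c \<alpha> * monomial k \<alpha> (\<lambda>i. f i z)"
    assume zero: "\<forall>q\<in>UNIV. ?R (?\<phi> q) = 0"
    have "?R \<in> polynomial_functions (entry_indices n)"
      by (intro polynomial_functions_sum polynomial_functions.mult polynomial_functions.const
          monomial_polynomial f)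
    from parametrization_dense[OF this] zero
    have "\<forall>z\<in>entries n ` SL2_tuples n. ?R z = 0" by blast
    then show "\<forall>\<alpha>\<in>exponents k M. c \<alpha> = 0"
      using indep unfolding alg_indep_on_def by blast
  qed
qed

section \<open>Words in matrices\<close>

lemma word_value_SL2_closed:
  "A \<in> SL2_tuples n \<Longrightarrow> w \<in> words n \<Longrightarrow> word_value SL2 A w \<in> carrier SL2"
  by (rule group.word_value_closed[OF group_SL2]) auto

text \<open>In \<open>SL\<^sub>2\<close> the inverse is the adjugate matrix, so inverse letters are polynomial too.\<close>

lemma word_value_polynomial:
  assumes "w \<in> words n"
  shows "\<exists>f\<in>polynomial_functions (entry_indices n).
    \<forall>A\<in>SL2_tuples n. f (entries n A) = word_value SL2 A w $ j $ k"
  using assms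
proof (induction w arbitrary: j k)
  case Nil
  show ?case
    by (rule bexI[of _ "\<lambda>p. mat 1 $ j $ k"]) (auto intro: polynomial_functions.const)
next
  case (Cons a w)
  then have i: "fst a < n" and w: "w \<in> words n" by auto
  let ?x = "\<lambda>A. if snd a then A (fst a) else inv\<^bsub>SL2\<^esub> (A (fst a))"
  have letter: "\<exists>f\<in>polynomial_functions (entry_indices n).
    \<forall>A\<in>SL2_tuples n. f (entries n A) = ?x A $ j $ l" for l
  proof (cases "snd a")
    case True
    with i show ?thesis
      by (intro bexI[OF _ entry_polynomial[OF i, of j l]]) (auto simp: entries_apply)
  next
    case False
    have inv: "inv\<^bsub>SL2\<^esub> (A (fst a)) = matrix2 (A (fst a) $ 2 $ 2) (- A (fst a) $ 1 $ 2)
        (- A (fst a) $ 2 $ 1) (A (fst a) $ 1 $ 1)" if "A \<in> SL2_tuples n" for A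
      using that i by (intro inv_SL2) auto
    consider "j = 1 \<and> l = 1" | "j = 2 \<and> l = 2" | "j = 1 \<and> l = 2" | "j = 2 \<and> l = 1"
      using exhaust_2[of j] exhaust_2[of l] by blast
    then show ?thesis
    proof cases
      case 1
      with False i show ?thesis
        by (intro bexI[OF _ entry_polynomial[OF i, of 2 2]]) (auto simp: entries_apply inv)
    next
      case 2
      with False i show ?thesis
        by (intro bexI[OF _ entry_polynomial[OF i, of 1 1]]) (auto simp: entries_apply inv)
    next
      case 3
      with False i show ?thesis
        by (intro bexI[OF _ polynomial_functions_uminus[OF entry_polynomial[OF i, of 1 2]]])
          (auto simp: entries_apply inv)
    next
      case 4
      with False i show ?thesis
        by (intro bexI[OF _ polynomial_functions_uminus[OF entry_polynomial[OF i, of 2 1]]])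
          (auto simp: entries_apply inv)
    qed
  qed
  from letter obtain f where f: "\<And>l. f l \<in> polynomial_functions (entry_indices n)"
    "\<And>l A. A \<in> SL2_tuples n \<Longrightarrow> f l (entries n A) = ?x A $ j $ l"
    by metis
  have "\<forall>l. \<exists>f\<in>polynomial_functions (entry_indices n).
      \<forall>A\<in>SL2_tuples n. f (entries n A) = word_value SL2 A w $ l $ k"
    using Cons.IH[OF w] by blast
  then obtain g where g: "\<And>l. g l \<in> polynomial_functions (entry_indices n)"
    "\<And>l A. A \<in> SL2_tuples n \<Longrightarrow> g l (entries n A) = word_value SL2 A w $ l $ k"
    by metis
  show ?case
  proof (rule bexI)
    show "\<forall>A\<in>SL2_tuples n. (\<Sum>l\<in>UNIV. f l (entries n A) * g l (entries n A)) =
        word_value SL2 A (a # w) $ j $ k"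
      using f(2) g(2) by (simp add: matrix_matrix_mult_def)
    show "(\<lambda>p. \<Sum>l\<in>UNIV. f l p * g l p) \<in> polynomial_functions (entry_indices n)"
      by (intro polynomial_functions_sum polynomial_functions.mult f(1) g(1))
  qed
qed

text \<open>Distinct points of the projective line, to be the attracting fixed points of the matrices
  assigned to the letters.\<close>

definition attractor :: "letter \<Rightarrow> complex" where
  "attractor a = of_nat (2 * fst a + (if snd a then 1 else 0))"

lemma attractor_eq_iff [simp]: "attractor a = attractor b \<longleftrightarrow> a = b"
  unfolding attractor_def of_nat_eq_iff by (cases a; cases b; auto; presburger)

text \<open>With \<open>P a\<close> the projection onto the line of \<open>attractor a\<close> along that of
  \<open>attractor (flip a)\<close>, this is \<open>P a + \<epsilon>\<^sup>2 \<cdot> P (flip a)\<close>.  Divided by \<open>\<epsilon>\<close> it has determinant 1, and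
  then \<open>a\<close> and \<open>flip a\<close> give inverse matrices.\<close>

definition attracting :: "complex \<Rightarrow> letter \<Rightarrow> complex^2^2" where
  "attracting \<epsilon> a = (let z = attractor a; y = attractor (flip a); \<delta> = z - y in
     matrix2 ((z - y * \<epsilon>\<^sup>2) / \<delta>) (- z * y * (1 - \<epsilon>\<^sup>2) / \<delta>) ((1 - \<epsilon>\<^sup>2) / \<delta>) ((z * \<epsilon>\<^sup>2 - y) / \<delta>))"

definition hyperbolic :: "complex \<Rightarrow> letter \<Rightarrow> complex^2^2" where
  "hyperbolic \<epsilon> a = (let M = attracting \<epsilon> a in
     matrix2 (M $ 1 $ 1 / \<epsilon>) (M $ 1 $ 2 / \<epsilon>) (M $ 2 $ 1 / \<epsilon>) (M $ 2 $ 2 / \<epsilon>))"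

lemma hyperbolic_SL2:
  assumes "\<epsilon> \<noteq> 0"
  shows "hyperbolic \<epsilon> a \<in> carrier SL2"
proof -
  let ?z = "attractor a" and ?y = "attractor (flip a)"
  have "(?z - ?y * \<epsilon>\<^sup>2) * (?z * \<epsilon>\<^sup>2 - ?y) - (- ?z * ?y * (1 - \<epsilon>\<^sup>2)) * (1 - \<epsilon>\<^sup>2) =
      ((?z - ?y) * \<epsilon>) * ((?z - ?y) * \<epsilon>)"
    by (simp add: power2_eq_square algebra_simps)
  moreover have "(?z - ?y) * \<epsilon> \<noteq> 0"
    using assms by simp
  ultimately show ?thesis
    by (simp only: carrier_SL2_iff hyperbolic_def attracting_def Let_def matrix2_sel
        divide_divide_eq_left times_divide_times_eq diff_divide_distrib[symmetric])
      simp
qed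

lemma inv_hyperbolic:
  assumes "\<epsilon> \<noteq> 0"
  shows "inv\<^bsub>SL2\<^esub> (hyperbolic \<epsilon> a) = hyperbolic \<epsilon> (flip a)"
proof -
  have swap: "u / (attractor (flip a) - attractor a) = - (u / (attractor a - attractor (flip a)))" for u
    by (metis minus_diff_eq divide_minus_right)
  show ?thesis
    unfolding inv_SL2[OF hyperbolic_SL2[OF assms]]
    by (simp add: matrix2_eq_iff hyperbolic_def attracting_def Let_def swap)
      (simp add: diff_divide_distrib mult.commute)
qed

lemma attracting_hyperbolic: "\<epsilon> \<noteq> 0 \<Longrightarrow> attracting \<epsilon> a *v v = \<epsilon> *s (hyperbolic \<epsilon> a *v v)"
  by (simp add: vec_eq_iff forall_2 hyperbolic_def Let_def matrix_vector_mult_def sum_2 field_simps)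

definition attractor_vec :: "letter \<Rightarrow> complex^2" where
  "attractor_vec a = vector [attractor a, 1]"

lemma attracting_0:
  "attracting 0 a *v attractor_vec b =
     ((attractor b - attractor (flip a)) / (attractor a - attractor (flip a))) *s attractor_vec a"
proof -
  let ?z = "attractor a" and ?y = "attractor (flip a)" and ?x = "attractor b"
  have "?z / (?z - ?y) * ?x - ?z * ?y / (?z - ?y) = (?x - ?y) / (?z - ?y) * ?z"
    "1 / (?z - ?y) * ?x - ?y / (?z - ?y) = (?x - ?y) / (?z - ?y)"
    by (simp_all add: diff_divide_distrib[symmetric] algebra_simps)
  then show ?thesis
    by (simp add: vec_eq_iff forall_2 attracting_def Let_def matrix_vector_mult_def sum_2
        attractor_vec_def)
qed

text \<open>At \<open>\<epsilon> = 0\<close> each letter of a reduced word maps the line attracted by its successor onto its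
  own one.  For \<open>\<epsilon> \<noteq> 0\<close>, if the word were trivial, the product would be the scalar
  \<open>\<epsilon> ^ length w\<close>, which tends to 0.\<close>

theorem word_value_SL2_faithful:
  assumes w: "w \<in> words n" "reduced w" "w \<noteq> []"
  shows "\<exists>A\<in>SL2_tuples n. word_value SL2 A w \<noteq> mat 1"
proof (rule ccontr)
  assume "\<not> ?thesis"
  then have trivial: "\<And>A. A \<in> SL2_tuples n \<Longrightarrow> word_value SL2 A w = mat 1" by blast
  \<comment> \<open>the last letter, so that \<open>w @ [b]\<close> is still reduced\<close>
  define b where "b = last w"
  define S where "S \<epsilon> u = foldr (\<lambda>a v. attracting \<epsilon> a *v v) u (attractor_vec b)" for \<epsilon> u
  have continuous: "continuous_on UNIV (\<lambda>\<epsilon>. S \<epsilon> u $ j)" for u j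
  proof (induction u arbitrary: j)
    case (Cons a u)
    have entry: "continuous_on UNIV (\<lambda>\<epsilon>. attracting \<epsilon> a $ j $ k)" for k
      using exhaust_2[of j] exhaust_2[of k]
      by (elim disjE) (auto simp: attracting_def Let_def intro!: continuous_intros)
    have "S \<epsilon> (a # u) $ j = (\<Sum>k\<in>UNIV. attracting \<epsilon> a $ j $ k * S \<epsilon> u $ k)" for \<epsilon>
      by (simp add: S_def matrix_vector_mult_def)
    then show ?case
      by (simp only:) (intro continuous_intros entry Cons.IH)
  qed (simp add: S_def)
  have at_0: "\<exists>c. c \<noteq> 0 \<and> S 0 u = c *s attractor_vec (hd (u @ [b]))" if "reduced (u @ [b])" for u
    using that
  proof (induction u)
    case Nil
    show ?case by (rule exI[of _ 1]) (simp add: S_def)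
  next
    case (Cons a u)
    then obtain c where c: "c \<noteq> 0" "S 0 u = c *s attractor_vec (hd (u @ [b]))"
      by (auto simp: reduced_Cons)
    have "hd (u @ [b]) \<noteq> flip a"
      using Cons.prems by (simp add: reduced_Cons)
    moreover have "S 0 (a # u) = c *s (attracting 0 a *v attractor_vec (hd (u @ [b])))"
      using c(2) by (simp add: S_def vector_scalar_commute)
    ultimately show ?case
      using c(1) unfolding attracting_0 vector_smult_assoc
      by (intro exI[of _ "c * ((attractor (hd (u @ [b])) - attractor (flip a)) /
          (attractor a - attractor (flip a)))"]) simp
  qed
  have scaled: "S \<epsilon> w $ 2 = \<epsilon> ^ length w" if \<epsilon>: "\<epsilon> \<noteq> 0" for \<epsilon>
  proof -
    define A where "A = (\<lambda>i\<in>{..<n}. hyperbolic \<epsilon> (i, True))"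
    have A: "A \<in> SL2_tuples n"
      using hyperbolic_SL2[OF \<epsilon>] by (auto simp: A_def)
    have "S \<epsilon> u = \<epsilon> ^ length u *s (word_value SL2 A u *v attractor_vec b)" if "u \<in> words n" for u
      using that
    proof (induction u)
      case Nil
      show ?case by (simp add: S_def)
    next
      case (Cons a u)
      have "(if snd a then A (fst a) else inv\<^bsub>SL2\<^esub> (A (fst a))) = hyperbolic \<epsilon> a"
        using Cons.prems inv_hyperbolic[OF \<epsilon>, of "(fst a, True)"]
        by (cases a) (auto simp: A_def flip_def)
      then have "word_value SL2 A (a # u) = hyperbolic \<epsilon> a ** word_value SL2 A u" by simp
      moreover have "S \<epsilon> (a # u) = attracting \<epsilon> a *v S \<epsilon> u" by (simp add: S_def)
      ultimately show ?case
        using Cons attracting_hyperbolic[OF \<epsilon>]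
        by (simp add: vector_scalar_commute vector_smult_assoc matrix_vector_mul_assoc mult.commute)
    qed
    from this[OF w(1)] trivial[OF A] show ?thesis
      by (simp add: attractor_vec_def)
  qed
  have "reduced (w @ [b])"
    using w(2,3) unfolding reduced_def b_def by (simp add: successively_append_iff)
  from at_0[OF this] have nonzero: "S 0 w $ 2 \<noteq> 0"
    by (auto simp: attractor_vec_def)
  have "((\<lambda>\<epsilon>. S \<epsilon> w $ 2) \<longlongrightarrow> S 0 w $ 2) (at 0)"
    using continuous[of w 2] by (simp add: continuous_on_def)
  moreover have "((\<lambda>\<epsilon>. S \<epsilon> w $ 2) \<longlongrightarrow> 0 ^ length w) (at 0)"
    by (rule Lim_transform_eventually[OF tendsto_power[OF tendsto_ident_at]])
      (auto simp: eventually_at_filter scaled)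
  ultimately have "S 0 w $ 2 = 0 ^ length w"
    by (rule tendsto_unique[OF trivial_limit_at])
  with nonzero w(3) show False by simp
qed

section \<open>Free generators\<close>

context group
begin

lemma word_value_push:
  assumes x: "x \<in> {..<n} \<rightarrow> carrier G" and "fst a < n" "w \<in> words n"
  shows "word_value G x (push a w) = word_value G x (a # w)"
proof (cases w)
  case (Cons b v)
  have "word_value G x v = word_value G x (a # flip a # v)"
  proof -
    have "x (fst a) \<in> carrier G" "word_value G x v \<in> carrier G"
      using assms word_value_closed[OF x, of v] Cons by auto
    then show ?thesis
      by (simp add: flip_def m_assoc[symmetric])
  qed
  with Cons show ?thesis by auto
qed simp

lemma word_value_foldr_push:
  assumes x: "x \<in> {..<n} \<rightarrow> carrier G" and "u \<in> words n" "v \<in> words n"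
  shows "word_value G x (foldr push u v) = word_value G x u \<otimes> word_value G x v"
  using assms(2)
proof (induction u)
  case Nil
  show ?case using word_value_closed[OF x assms(3)] by simp
next
  case (Cons a u)
  then have "x (fst a) \<in> carrier G" "word_value G x u \<in> carrier G"
    using x word_value_closed[OF x, of u] by auto
  with Cons show ?case
    using word_value_closed[OF x assms(3)]
    by (simp add: word_value_push[OF x] words_foldr_push assms(3) m_assoc)
qed

lemma iso_free_group_if_no_relations:
  assumes x: "x \<in> {..<n} \<rightarrow> carrier G" and gen: "generate G (x ` {..<n}) = carrier G"
    and free: "\<And>w. w \<in> words n \<Longrightarrow> reduced w \<Longrightarrow> word_value G x w = \<one> \<Longrightarrow> w = []"
  shows "G \<cong> free_group n"
proof -
  interpret F: group "free_group n" by (rule group_free_group)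
  have hom: "word_value G x \<in> hom (free_group n) G"
    by (rule homI) (auto simp: free_group_def word_value_closed[OF x] word_value_foldr_push[OF x])
  then interpret wv: group_hom "free_group n" G "word_value G x"
    by (simp add: group_hom_def group_hom_axioms_def F.group_axioms group_axioms)
  have "inj_on (word_value G x) (carrier (free_group n))"
    unfolding wv.inj_on_one_iff using free by (auto simp: free_group_def)
  moreover have "word_value G x ` carrier (free_group n) = carrier G"
  proof
    show "word_value G x ` carrier (free_group n) \<subseteq> carrier G"
      using wv.hom_closed by blast
    show "carrier G \<subseteq> word_value G x ` carrier (free_group n)"
    proof
      fix g assume "g \<in> carrier G"
      then obtain w where w: "w \<in> words n" "word_value G x w = g"
        using word_value_surj[OF x] gen by blast
      then have "word_value G x (foldr push w []) = g"
        using word_value_foldr_push[OF x w(1), of "[]"] word_value_closed[OF x w(1)] by simp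
      moreover have "foldr push w [] \<in> carrier (free_group n)"
        using w(1) by (simp add: free_group_def reduced_foldr_push words_foldr_push)
      ultimately show "g \<in> word_value G x ` carrier (free_group n)" by blast
    qed
  qed
  ultimately have "word_value G x \<in> iso (free_group n) G"
    using hom by (simp add: iso_def bij_betw_def)
  then have "free_group n \<cong> G" by (auto simp: is_iso_def)
  then show ?thesis by (rule F.iso_sym)
qed

end

section \<open>The dimension of the representation variety\<close>

lemma rep_tuples_subset: "rep_tuples G n x \<subseteq> SL2_tuples n"
  by (auto simp: rep_tuples_def)

lemma chain_length_le:
  assumes "chain_in (entry_indices n) (entries n ` rep_tuples G n x) k C"
  shows "k \<le> 3 * n"
proof -
  obtain f where f: "\<forall>i<k. f i \<in> polynomial_functions (entry_indices n)" "alg_indep_on (C k) k f"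
    using alg_indep_on_chain[OF assms] by blast
  have "C k \<subseteq> entries n ` rep_tuples G n x"
    using assms unfolding chain_in_def by blast
  also have "\<dots> \<subseteq> entries n ` SL2_tuples n"
    using rep_tuples_subset by blast
  finally show ?thesis
    using alg_indep_on_SL2_tuples_le[OF alg_indep_on_mono[OF f(2)]] f(1) by blast
qed

text \<open>Letting the coordinates of the parametrization become nonzero one after the other, the factor
  with index \<open>k div 3\<close> grows from the identity to the upper unipotent matrices, then to the matrices
  with lower right entry 1, then to a dense subset.  The step number \<open>k\<close> is detected by the
  following function.\<close>

definition switched_entry :: "nat \<Rightarrow> complex^2^2 \<Rightarrow> complex" where
  "switched_entry k M = (if k mod 3 = 0 then M $ 1 $ 2 else if k mod 3 = 1 then M $ 2 $ 1
     else M $ 2 $ 2 - 1)"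

lemma switched_entry_parametrization:
  assumes "k < 3 * n"
  shows "q \<in> coordinate_subspace k \<Longrightarrow> switched_entry k (parametrization n q (k div 3)) = 0"
    and "\<exists>q\<in>coordinate_subspace (Suc k). switched_entry k (parametrization n q (k div 3)) \<noteq> 0"
proof -
  define j where "j = k div 3"
  have j: "j < n" using assms by (simp add: j_def)
  have "k = 3 * j + k mod 3" by (simp add: j_def)
  then consider "k = 3 * j" "k mod 3 = 0" | "k = 3 * j + 1" "k mod 3 = 1" | "k = 3 * j + 2" "k mod 3 = 2"
    by linarith
  note k_cases = this
  show "switched_entry k (parametrization n q (k div 3)) = 0" if "q \<in> coordinate_subspace k"
    using k_cases
    by cases (use that j in \<open>simp_all add: j_def[symmetric] switched_entry_def parametrization_def
      unipotent_product_def coordinate_subspace_def\<close>)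
  let ?q = "\<lambda>i. if i \<le> k then 1 else 0 :: complex"
  have "switched_entry k (parametrization n ?q (k div 3)) \<noteq> 0"
    using k_cases
    by cases (use j in \<open>simp_all add: j_def[symmetric] switched_entry_def parametrization_def
      unipotent_product_def\<close>)
  moreover have "?q \<in> coordinate_subspace (Suc k)"
    by (simp add: coordinate_subspace_def)
  ultimately show "\<exists>q\<in>coordinate_subspace (Suc k).
      switched_entry k (parametrization n q (k div 3)) \<noteq> 0" by blast
qed

text \<open>The generators \<open>x i\<close> need not be the free basis \<open>y i\<close> that corresponds to the letters under
  the isomorphism.  A tuple \<open>A\<close>, seen as the values of a representation on the \<open>y i\<close>, has the values
  \<open>\<psi> A\<close> on the \<open>x i\<close>; writing \<open>y i\<close> as the word \<open>v i\<close> in the \<open>x i\<close> recovers \<open>A\<close> from \<open>\<psi> A\<close>.  So the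
  functions that separate the closures in \<open>SL\<^sub>2\<^sup>n\<close> can be transported by the words \<open>v i\<close>.\<close>

lemma chain_in_rep_variety:
  fixes G (structure)
  assumes "group G" and x: "x \<in> {..<n} \<rightarrow> carrier G"
    and gen: "generate G (x ` {..<n}) = carrier G" and iso: "G \<cong> free_group n"
  shows "\<exists>C. chain_in (entry_indices n) (entries n ` rep_tuples G n x) (3 * n) C"
proof -
  interpret group G by fact
  let ?P = "polynomial_functions (entry_indices n)"
  obtain h where h: "h \<in> hom G (free_group n)" "bij_betw h (carrier G) (carrier (free_group n))"
    using iso by (auto simp: is_iso_def iso_def)
  have h_word: "h g \<in> words n" if "g \<in> carrier G" for g
    using h(1) that by (auto simp: hom_def free_group_def)
  define \<rho> where "\<rho> A g = word_value SL2 A (h g)" for A g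
  define \<psi> where "\<psi> A = (\<lambda>i\<in>{..<n}. \<rho> A (x i))" for A
  have \<rho>: "\<rho> A \<in> hom G SL2" if A: "A \<in> SL2_tuples n" for A
  proof (rule homI)
    fix g g' assume g: "g \<in> carrier G" "g' \<in> carrier G"
    show "\<rho> A g \<in> carrier SL2"
      unfolding \<rho>_def by (rule word_value_SL2_closed[OF A h_word[OF g(1)]])
    have "h (g \<otimes> g') = foldr push (h g) (h g')"
      using h(1) g by (auto simp: hom_def free_group_def)
    then show "\<rho> A (g \<otimes> g') = \<rho> A g \<otimes>\<^bsub>SL2\<^esub> \<rho> A g'"
      unfolding \<rho>_def using A g
      by (simp only:) (rule group.word_value_foldr_push[OF group_SL2, of _ n], auto intro: h_word)
  qed
  have \<psi>: "\<psi> A \<in> rep_tuples G n x" if "A \<in> SL2_tuples n" for A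
    unfolding rep_tuples_eq_hom[OF x gen] \<psi>_def using \<rho>[OF that] by blast
  have "\<exists>v\<in>words n. \<forall>A\<in>SL2_tuples n. word_value SL2 (\<psi> A) v = A i" if i: "i < n" for i
  proof -
    have "[(i, True)] \<in> carrier (free_group n)"
      using i by (simp add: free_group_def reduced_def)
    then obtain y where y: "y \<in> carrier G" "h y = [(i, True)]"
      using h(2) by (metis bij_betw_imp_surj_on imageE)
    then obtain v where v: "v \<in> words n" "word_value G x v = y"
      using word_value_surj[OF x] gen by blast
    have "word_value SL2 (\<psi> A) v = A i" if "A \<in> SL2_tuples n" for A
      unfolding \<psi>_def word_value_hom[OF group_SL2 \<rho>[OF that] x v(1)]
      by (simp add: v(2) \<rho>_def y(2))
    with v(1) show ?thesis by blast
  qed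
  then obtain v where v: "\<And>i. i < n \<Longrightarrow> v i \<in> words n"
    "\<And>i A. i < n \<Longrightarrow> A \<in> SL2_tuples n \<Longrightarrow> word_value SL2 (\<psi> A) (v i) = A i"
    by metis
  have "\<forall>w\<in>words n. \<forall>j k. \<exists>f\<in>?P. \<forall>A\<in>SL2_tuples n. f (entries n A) = word_value SL2 A w $ j $ k"
    using word_value_polynomial by blast
  then obtain p where p: "\<And>w j k. w \<in> words n \<Longrightarrow> p w j k \<in> ?P"
    "\<And>w j k A. w \<in> words n \<Longrightarrow> A \<in> SL2_tuples n \<Longrightarrow>
      p w j k (entries n A) = word_value SL2 A w $ j $ k"
    by metis
  define g where "g k = (if k mod 3 = 0 then p (v (k div 3)) 1 2
    else if k mod 3 = 1 then p (v (k div 3)) 2 1 else (\<lambda>z. p (v (k div 3)) 2 2 z - 1))" for k :: nat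
  have g_value: "g k (entries n (\<psi> A)) = switched_entry k (A (k div 3))"
    if "k < 3 * n" "A \<in> SL2_tuples n" for k A
  proof -
    have "k div 3 < n" using that(1) by simp
    moreover have "\<psi> A \<in> SL2_tuples n" using \<psi>[OF that(2)] rep_tuples_subset by blast
    ultimately show ?thesis
      using that(2) by (simp add: g_def switched_entry_def p(2) v)
  qed
  show ?thesis
  proof (rule chain_in_of_parametrization[where \<phi> = "\<lambda>q. entries n (\<psi> (parametrization n q))"
        and g = g and J = "{..<3 * n}"])
    show "entries n (\<psi> (parametrization n q)) \<in> entries n ` rep_tuples G n x" for q
      using \<psi>[OF parametrization_SL2] by blast
    show "(\<lambda>q. entries n (\<psi> (parametrization n q)) i) \<in> polynomial_functions {..<3 * n}"
      if i_index: "i \<in> entry_indices n" for i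
    proof -
      obtain m j k where i: "i = (m, j, k)" "m < n"
        using i_index by (auto simp: entry_indices_def)
      then have w: "h (x m) \<in> words n" using x by (intro h_word) auto
      have "entries n (\<psi> (parametrization n q)) i =
          p (h (x m)) j k (entries n (parametrization n q))" for q
        using i by (simp add: entries_apply \<psi>_def \<rho>_def p(2)[OF w parametrization_SL2])
      then show ?thesis
        using polynomial_functions_compose[OF p(1)[OF w] parametrization_polynomial] by simp
    qed
    show "g k \<in> ?P" if "k < 3 * n" for k
    proof -
      have "k div 3 < n" using that by simp
      then show ?thesis
        unfolding g_def
        by (auto intro!: p(1) v(1) polynomial_functions_diff polynomial_functions.const)
    qed
    show "g k (entries n (\<psi> (parametrization n q))) = 0"
      if "k < 3 * n" "q \<in> coordinate_subspace k" for k q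
      using that switched_entry_parametrization(1) g_value parametrization_SL2 by simp
    show "\<exists>q\<in>coordinate_subspace (Suc k). g k (entries n (\<psi> (parametrization n q))) \<noteq> 0"
      if "k < 3 * n" for k
      using that switched_entry_parametrization(2) g_value parametrization_SL2 by simp
  qed
qed

text \<open>A relation cuts out a proper closed subset of the irreducible variety \<open>SL\<^sub>2\<^sup>n\<close>, which leaves
  room for one more independent function.\<close>

lemma chain_length_less:
  fixes G (structure)
  assumes w: "w \<in> words n" "reduced w" "w \<noteq> []" and rel: "word_value G x w = \<one>"
    and chain: "chain_in (entry_indices n) (entries n ` rep_tuples G n x) k C"
  shows "k < 3 * n"
proof -
  let ?P = "polynomial_functions (entry_indices n)"
  obtain f where f: "\<forall>i<k. f i \<in> ?P" "alg_indep_on (C k) k f"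
    using alg_indep_on_chain[OF chain] by blast
  obtain A where A: "A \<in> SL2_tuples n" "word_value SL2 A w \<noteq> mat 1"
    using word_value_SL2_faithful[OF w] by blast
  then obtain i j where ij: "word_value SL2 A w $ i $ j \<noteq> mat 1 $ i $ j"
    by (auto simp: vec_eq_iff)
  obtain p where p: "p \<in> ?P"
    "\<And>A. A \<in> SL2_tuples n \<Longrightarrow> p (entries n A) = word_value SL2 A w $ i $ j"
    using word_value_polynomial[OF w(1)] by metis
  define g where "g z = p z - mat 1 $ i $ j" for z
  have g: "g \<in> ?P"
    unfolding g_def by (intro polynomial_functions_diff p(1) polynomial_functions.const)
  have Ck: "C k \<subseteq> entries n ` rep_tuples G n x"
    using chain unfolding chain_in_def by blast
  have "alg_indep_on (entries n ` SL2_tuples n) (Suc k) (f(k := g))"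
  proof (rule alg_indep_on_step[OF _ f(2), where I = "entry_indices n"])
    show "C k \<subseteq> entries n ` SL2_tuples n"
      using Ck rep_tuples_subset by blast
    show "g z = 0" if z: "z \<in> C k" for z
    proof -
      obtain B where B: "B \<in> rep_tuples G n x" "z = entries n B"
        using z Ck by blast
      then have "B \<in> SL2_tuples n" using rep_tuples_subset by blast
      moreover have "word_value SL2 B w = mat 1"
        using B(1) w(1) rel by (simp add: rep_tuples_def)
      ultimately show ?thesis
        by (simp add: g_def B(2) p(2))
    qed
    show "\<exists>z\<in>entries n ` SL2_tuples n. g z \<noteq> 0"
      using A(1) ij by (intro bexI[of _ "entries n A"]) (auto simp: g_def p(2))
    show "u \<in> ?P \<Longrightarrow> v \<in> ?P \<Longrightarrow> \<forall>z\<in>entries n ` SL2_tuples n. u z * v z = 0 \<Longrightarrow>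
        (\<forall>z\<in>entries n ` SL2_tuples n. u z = 0) \<or> (\<forall>z\<in>entries n ` SL2_tuples n. v z = 0)" for u v
      using domain_on_SL2_tuples[of n] unfolding domain_on_def by blast
  qed (use f(1) g in auto)
  then have "Suc k \<le> 3 * n"
    by (rule alg_indep_on_SL2_tuples_le) (use f(1) g in \<open>auto simp: less_Suc_eq\<close>)
  then show ?thesis by simp
qed

theorem theorem1p4:
  fixes G :: "('a, 'b) monoid_scheme" and n :: nat and x :: "nat \<Rightarrow> 'a"
  assumes "group G"
    and "n \<ge> 1"
    and "x \<in> {..<n} \<rightarrow> carrier G"
    and "generate G (x ` {..<n}) = carrier G"
  shows "G \<cong> free_group n \<longleftrightarrow> krull_dim (rep_variety G n x) = enat (3 * n)"
proof -
  have Z: "entries n ` rep_tuples G n x \<subseteq> entry_indices n \<rightarrow>\<^sub>E UNIV"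
    using entries_in_affine_space by blast
  show ?thesis
  proof
    assume "G \<cong> free_group n"
    then show "krull_dim (rep_variety G n x) = enat (3 * n)"
      unfolding rep_variety_def
      by (intro krull_dim_eqI[OF Z] chain_length_le chain_in_rep_variety assms)
  next
    assume "krull_dim (rep_variety G n x) = enat (3 * n)"
    then obtain C where "chain_in (entry_indices n) (entries n ` rep_tuples G n x) (3 * n) C"
      using krull_dim_eqD[OF Z] assms(2) unfolding rep_variety_def by auto
    then have "w = []" if "w \<in> words n" "reduced w" "word_value G x w = \<one>\<^bsub>G\<^esub>" for w
      using chain_length_less[OF that(1,2) _ that(3)] by blast
    then show "G \<cong> free_group n"
      by (rule group.iso_free_group_if_no_relations[OF assms(1,3,4)])
  qed
qed

end
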